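(* Let $p^h\in U^h$ be the finite element solution of the flow problem, i.e. $d(p^h,v^h)=f(v^h)$ for all $v^h\in V^h$, and let $q_D(\Omega)\in G^h$ be the associated Dirichlet boundary flux, i.e. $(q_D(\Omega),v^h)_{\Gamma_D}=d(p^h,v^h)-f(v^h)$ for all $v^h\in G^h$. Let $\Omega_1,\Omega_2\subset\Omega$ be two non-overlapping subdomains with $\overline\Omega_1\cup\overline\Omega_2=\overline\Omega$, with boundaries $\Gamma_1,\Gamma_2$ and interface $L=\Gamma_1\cap\Gamma_2$ (which is not required to coincide with sides of mesh elements), such that $\Gamma_1=L\cup\Gamma_1^N$ and $\Gamma_2=L\cup\Gamma_2^N\cup\Gamma_D$, where $\Gamma_a^N=\Gamma_a\cap\Gamma_N$ for $a\in\{1,2\}$. Let the approximate interface fluxes $q_L(\Omega_1),q_L(\Omega_2)\in G_L^h$ be solutions of $$(v^h,q_L(\Omega_1))_L=d_1(p^h,v^h)-f_1(v^h)\qquad\text{for all } v^h\in S^h,$$ $$(v^h,q_L(\Omega_2))_L=d_2(p^h,v^h)-f_2(v^h)-(v^h,q_D(\Omega))_{\Gamma_D}\qquad\text{for all } v^h\in S^h .$$ Then the method is locally conservative across $L$: (i) each flux is conservative with respect to its subdomain: $$\int_L q_L(\Omega_1)\,\mathrm d\Gamma+\int_{\Gamma_1^N}h\,\mathrm d\Gamma=0,\qquad \int_L q_L(\Omega_2)\,\mathrm d\Gamma+\int_{\Gamma_2^N}h\,\mathrm d\Gamma+\int_{\Gamma_D}q_D(\Omega)\,\mathrm d\Gamma=0;$$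 (ii) the two fluxes equilibrate on $L$: $$(v^h,\;q_L(\Omega_1)+q_L(\Omega_2))_L=0\qquad\text{for all } v^h\in G_L^h .$$
   Context: Domain and data: $\Omega\subset\mathbb R^d$, $d\in\{2,3\}$, is an axis-aligned box, whose boundary is decomposed as $\partial\Omega=\overline\Gamma_D\cup\overline\Gamma_N$, where $\Gamma_D$ and $\Gamma_N$ have disjoint interiors. $\Omega$ is split into a fracture part $\Omega_f$ (a finite union of boxes contained in $\Omega$) and a matrix part $\Omega_m=\Omega\setminus\Omega_f$. The permeability $k$ is a positive function equal to a constant $k_m>0$ in $\Omega_m$ and to a constant $k_f>0$ in $\Omega_f$. The flow problem is $\nabla\cdot(-k\nabla p)=0$ in $\Omega$, $p=g$ on $\Gamma_D$, $k\nabla p\cdot n=h$ on $\Gamma_N$, where $n$ is the outward unit normal. Here $h$ (not to be confused with the superscript $h$ marking discrete objects) is a given Neumann datum, square integrable on $\Gamma_N$. Put $$d(p,v)=\int_\Omega k\,\nabla p\cdot\nabla v\,\mathrm dV,\qquad f(v)=\int_{\Gamma_N}h\,v\,\mathrm d\Gamma,$$ and, for $a\in\{1,2\}$, $$d_a(p,v)=\int_{\Omega_a}k\,\nabla p\cdot\nabla v\,\mathrm d\Omega,\qquad f_a(v)=\int_{\Gamma_a^N}h\,v\,\mathrm d\Gamma .$$ $(\cdot,\cdot)_{\Xi}$ denotes the $L^2(\Xi)$ scalar product. Mesh: $\mathcal T$ is a mesh of $\Omega$ whose elements are all of the same type (triangles or quadrilaterals for $d=2$; tetrahedra or hexahedra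 for $d=3$). The mesh may be non-conforming: a vertex of one element may lie in the interior of an edge or a face of another element; such a vertex is called hanging, and all other vertices are called regular. The mesh is $1$-irregular: the interior of an edge or face contains at most one hanging vertex, which is the center of that edge or face. Let $J^r$ be the index set of the regular vertices $\mathbf x_i$. Discrete spaces: $\mathbb L_1$ denotes the linear functions on an element (triangles, tetrahedra) or the multilinear functions (quadrilaterals, hexahedra). $S^h=\{v\in C^0(\Omega): v|_E\in\mathbb L_1\text{ for every element }E\}$, which is spanned by the conforming Lagrangian basis functions $N^r_i\in S^h$, $i\in J^r$, characterized by $N^r_i(\mathbf x_j)=\delta_{ij}$ for $i,j\in J^r$. Let $D=\{i\in J^r:\mathbf x_i\in\Gamma_D\}$. Then $U^h=\{v\in S^h: v=g\text{ on }\Gamma_D\}$, $V^h=\{v\in S^h: v=0\text{ on }\Gamma_D\}=\mathrm{span}\{N^r_i\}_{i\in J^r\setminus D}$, $G^h=\mathrm{span}\{N^r_i\}_{i\in D}$, and $S^h=V^h\oplus G^h$. Finally, $G_L^h=\mathrm{span}\{N_i^r: i\in J^r_L\}$, where $J^r_L=\{i\in J^r: |\mathrm{supp}(N_i^r)\cap L|>0\}$ and $|\cdot|$ is the $(d-1)$-dimensional measure on $L$.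
   Formalization: The subdomains are assumed to have boundaries of finite (d-1)-dimensional measure, and L is assumed to meet the Neumann boundary only in a set of (d-1)-dimensional measure zero; both hold for Lipschitz or polyhedral subdomains, and without the second (ii) can fail. *)

theory Defs
  imports "HOL-Analysis.Analysis"
begin

text \<open>The \<open>s\<close>-dimensional Hausdorff outer measure, with the usual normalisation that makes it
  agree with Lebesgue measure on \<open>s\<close>-dimensional planes. Only \<open>s > 0\<close> is meant: for \<open>s = 0\<close> the
  convention \<open>0 ^ 0 = 1\<close> would charge empty covering sets. Boundedness of the covering sets is
  explicit because the library's \<^const>\<open>diameter\<close> is meaningless on unbounded sets.\<close>

definition hausdorff_cover :: "real \<Rightarrow> 'a::metric_space set \<Rightarrow> (nat \<Rightarrow> 'a set) set" where
  "hausdorff_cover \<delta> A =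
     {C. A \<subseteq> (\<Union>n. C n) \<and> (\<forall>n. bounded (C n) \<and> diameter (C n) \<le> \<delta>)}"

definition hausdorff_weight :: "nat \<Rightarrow> 'a::metric_space set \<Rightarrow> ennreal" where
  "hausdorff_weight s C = ennreal (unit_ball_vol (real s) * (diameter C / 2) ^ s)"

definition hausdorff_outer :: "nat \<Rightarrow> 'a::metric_space set \<Rightarrow> ennreal" where
  "hausdorff_outer s A =
     (SUP \<delta>\<in>{0<..}. INF C\<in>hausdorff_cover \<delta> A. \<Sum>n. hausdorff_weight s (C n))"

definition hausdorff_measure :: "nat \<Rightarrow> 'a::metric_space measure" where
  "hausdorff_measure s = measure_of UNIV (sets borel) (hausdorff_outer s)"

text \<open>The Hausdorff outer measure is a metric outer measure, hence countably additive on Borel sets,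
  so the \<^const>\<open>measure_of\<close> above does not fall back to the zero measure.\<close>

lemma ennreal_tail_lim:
  fixes f :: "nat \<Rightarrow> ennreal"
  assumes "(\<Sum>m. f m) \<noteq> top"
  shows "(\<lambda>n. \<Sum>m. f (m + n)) \<longlonglongrightarrow> 0"
proof -
  have eq: "(\<Sum>m. f (m + n)) = (\<Sum>m. f m) - (\<Sum>m<n. f m)" for n
  proof -
    have "(\<Sum>m<n. f m) \<noteq> top"
      using assms sum_le_suminf[OF summableI, of "{..<n}" f] by (metis finite_lessThan top.extremum_uniqueI zero_le)
    moreover have "(\<Sum>m. f m) = (\<Sum>m. f (m + n)) + (\<Sum>m<n. f m)"
      by (rule suminf_offset) auto
    ultimately show ?thesis
      by (simp add: ennreal_add_diff_cancel_right)
  qed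
  have "(\<lambda>n. (\<Sum>m. f m) - (\<Sum>m<n. f m)) \<longlonglongrightarrow> (\<Sum>m. f m) - (\<Sum>m. f m)"
    using assms by (intro tendsto_diff_ennreal tendsto_const summable_LIMSEQ summableI) auto
  then show ?thesis
    using assms by (simp add: eq)
qed


lemma hausdorff_cover_antimono: "A \<subseteq> B \<Longrightarrow> hausdorff_cover \<delta> B \<subseteq> hausdorff_cover \<delta> A"
  by (auto simp: hausdorff_cover_def)

lemma hausdorff_cover_mono: "\<delta> \<le> \<epsilon> \<Longrightarrow> hausdorff_cover \<delta> A \<subseteq> hausdorff_cover \<epsilon> A"
  by (auto simp: hausdorff_cover_def intro: order_trans)

lemma hausdorff_outer_mono: "A \<subseteq> B \<Longrightarrow> hausdorff_outer s A \<le> hausdorff_outer s B"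
  unfolding hausdorff_outer_def
  by (intro SUP_mono') (intro INF_superset_mono hausdorff_cover_antimono order_refl)

lemma hausdorff_weight_empty: "s > 0 \<Longrightarrow> hausdorff_weight s {} = 0"
  by (simp add: hausdorff_weight_def)

lemma hausdorff_outer_empty:
  assumes "s > 0" shows "hausdorff_outer s ({} :: 'a::metric_space set) = 0"
proof -
  have "(INF C\<in>hausdorff_cover \<delta> ({} :: 'a set). \<Sum>n. hausdorff_weight s (C n)) = 0"
    if "\<delta> > 0" for \<delta>
  proof -
    have "(\<lambda>_. {}) \<in> hausdorff_cover \<delta> ({} :: 'a set)"
      using that by (auto simp: hausdorff_cover_def)
    from INF_lower[OF this, of "\<lambda>C. \<Sum>n. hausdorff_weight s (C n)"] show ?thesis
      by (simp add: hausdorff_weight_empty[OF assms])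
  qed
  then show ?thesis
    by (simp add: hausdorff_outer_def)
qed

lemma hausdorff_outer_countable_subadditive:
  fixes A :: "nat \<Rightarrow> 'a::metric_space set"
  shows "hausdorff_outer s (\<Union>i. A i) \<le> (\<Sum>i. hausdorff_outer s (A i))"
proof (subst (1) hausdorff_outer_def, rule SUP_least)
  fix \<delta> :: real assume \<delta>: "\<delta> \<in> {0<..}"
  let ?m = "\<lambda>C. \<Sum>n. hausdorff_weight s (C n)"
  define H where "H = (\<lambda>A :: 'a set. INF C\<in>hausdorff_cover \<delta> A. ?m C)"
  have le: "H B \<le> hausdorff_outer s B" for B
    unfolding H_def hausdorff_outer_def using \<delta> by (intro SUP_upper)
  have "H (\<Union>i. A i) \<le> (\<Sum>i. H (A i))"
  proof (rule ennreal_le_epsilon)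
    fix e :: real
    assume e: "e > 0" and fin: "(\<Sum>i. H (A i)) < top"
    have "\<exists>C\<in>hausdorff_cover \<delta> (A i). ?m C < H (A i) + ennreal (e * (1/2) ^ Suc i)" for i
    proof -
      have "H (A i) < top"
        using fin by (metis ennreal_suminf_lessD)
      then have "H (A i) < H (A i) + ennreal (e * (1/2) ^ Suc i)"
        using e ennreal_add_left_cancel_less[of "H (A i)" 0 "ennreal (e * (1/2) ^ Suc i)"] by simp
      then show ?thesis
        by (subst (asm) (1) H_def) (simp add: INF_less_iff)
    qed
    then obtain C where C: "\<And>i. C i \<in> hausdorff_cover \<delta> (A i)"
        and m: "\<And>i. ?m (C i) < H (A i) + ennreal (e * (1/2) ^ Suc i)"
      by metis
    define D where "D = (\<lambda>n. (\<lambda>(i, j). C i j) (prod_decode n))"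
    have D: "D \<in> hausdorff_cover \<delta> (\<Union>i. A i)"
    proof -
      have "x \<in> (\<Union>n. D n)" if "x \<in> A i" for x i
      proof -
        have "A i \<subseteq> (\<Union>j. C i j)"
          using C[of i] by (simp add: hausdorff_cover_def)
        with that obtain j where "x \<in> C i j" by blast
        then have "x \<in> D (prod_encode (i, j))"
          by (simp add: D_def)
        then show ?thesis by blast
      qed
      moreover have "bounded (D n) \<and> diameter (D n) \<le> \<delta>" for n
        using C by (auto simp: D_def hausdorff_cover_def split: prod.split)
      ultimately show ?thesis
        by (auto simp: hausdorff_cover_def)
    qed
    have "H (\<Union>i. A i) \<le> ?m D"
      unfolding H_def using D by (intro INF_lower)
    also have "?m D = (\<Sum>i. ?m (C i))"
    proof -
      have "(\<Sum>n. (\<lambda>(i, j). hausdorff_weight s (C i j)) (prod_decode n)) = (\<Sum>i. ?m (C i))"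
        using suminf_ennreal_2dimen[of "\<lambda>i. ?m (C i)" "\<lambda>(i, j). hausdorff_weight s (C i j)"]
        by (simp add: o_def)
      then show ?thesis
        by (simp add: D_def case_prod_beta)
    qed
    also have "\<dots> \<le> (\<Sum>i. H (A i) + ennreal (e * (1/2) ^ Suc i))"
      using m by (intro suminf_le summableI) (auto intro: less_imp_le)
    also have "\<dots> = (\<Sum>i. H (A i)) + (\<Sum>i. ennreal (e * (1/2) ^ Suc i))"
      by (intro suminf_add[symmetric] summableI)
    also have "(\<Sum>i. ennreal (e * (1/2) ^ Suc i)) = ennreal e"
      using sums_mult[OF power_half_series, of e] e
      by (intro suminf_ennreal_eq) auto
    finally show "H (\<Union>i. A i) \<le> (\<Sum>i. H (A i)) + ennreal e" .
  qed
  also have "\<dots> \<le> (\<Sum>i. hausdorff_outer s (A i))"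
    by (intro suminf_le le summableI)
  finally show "(INF C\<in>hausdorff_cover \<delta> (\<Union>i. A i). ?m C) \<le> (\<Sum>i. hausdorff_outer s (A i))"
    by (simp add: H_def)
qed

lemma hausdorff_outer_subadditive:
  assumes "s > 0"
  shows "hausdorff_outer s (A \<union> B) \<le> hausdorff_outer s A + hausdorff_outer s B"
proof -
  define X where "X = (\<lambda>n::nat. if n = 0 then A else if n = 1 then B else {})"
  have "A \<union> B = (\<Union>n. X n)"
  proof -
    have "A = X 0" "B = X 1" by (simp_all add: X_def)
    moreover have "X n \<subseteq> A \<union> B" for n by (simp add: X_def)
    ultimately show ?thesis by blast
  qed
  then have "hausdorff_outer s (A \<union> B) \<le> (\<Sum>n. hausdorff_outer s (X n))"
    using hausdorff_outer_countable_subadditive[of s X] by simp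
  also have "\<dots> = (\<Sum>n\<in>{0,1}. hausdorff_outer s (X n))"
    by (intro suminf_finite) (auto simp: X_def hausdorff_outer_empty[OF assms])
  finally show ?thesis
    by (simp add: X_def)
qed

lemma hausdorff_outer_separated:
  fixes A B :: "'a::metric_space set"
  assumes s: "s > 0" and \<eta>: "\<eta> > 0" and sep: "\<And>x y. x \<in> A \<Longrightarrow> y \<in> B \<Longrightarrow> \<eta> \<le> dist x y"
  shows "hausdorff_outer s A + hausdorff_outer s B \<le> hausdorff_outer s (A \<union> B)"
proof -
  let ?m = "\<lambda>C. \<Sum>n. hausdorff_weight s (C n)"
  define H where "H = (\<lambda>\<delta> (A :: 'a set). INF C\<in>hausdorff_cover \<delta> A. ?m C)"
  have anti: "H \<epsilon> X \<le> H \<delta> X" if "\<delta> \<le> \<epsilon>" for \<delta> \<epsilon> X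
    unfolding H_def by (intro INF_superset_mono hausdorff_cover_mono that order_refl)
  have outer: "hausdorff_outer s X = (SUP \<delta>\<in>{0<..}. H \<delta> X)" for X
    by (simp add: hausdorff_outer_def H_def)
  have small: "H \<delta> A + H \<delta> B \<le> H \<delta> (A \<union> B)" if \<delta>: "0 < \<delta>" "\<delta> < \<eta>" for \<delta>
    unfolding fun_cong[OF fun_cong[OF H_def], of \<delta> "A \<union> B"]
  proof (rule INF_greatest)
    fix C assume C: "C \<in> hausdorff_cover \<delta> (A \<union> B)"
    define CA where "CA = (\<lambda>n. if C n \<inter> A = {} then {} else C n)"
    define CB where "CB = (\<lambda>n. if C n \<inter> B = {} then {} else C n)"
    have cov: "bounded (C n)" "diameter (C n) \<le> \<delta>" for n
      using C by (auto simp: hausdorff_cover_def)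
    have "CA \<in> hausdorff_cover \<delta> A" "CB \<in> hausdorff_cover \<delta> B"
      using C \<delta> by (fastforce simp: hausdorff_cover_def CA_def CB_def)+
    then have "H \<delta> A + H \<delta> B \<le> ?m CA + ?m CB"
      unfolding H_def by (intro add_mono INF_lower)
    also have "\<dots> = (\<Sum>n. hausdorff_weight s (CA n) + hausdorff_weight s (CB n))"
      by (intro suminf_add summableI)
    also have "\<dots> \<le> ?m C"
    proof (intro suminf_le summableI)
      fix n
      have "C n \<inter> A = {} \<or> C n \<inter> B = {}"
      proof (rule ccontr)
        assume "\<not> ?thesis"
        then obtain x y where "x \<in> C n" "x \<in> A" "y \<in> C n" "y \<in> B" by blast
        then have "\<eta> \<le> dist x y" "dist x y \<le> diameter (C n)"
          using sep cov diameter_bounded_bound by blast+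
        then show False using cov(2)[of n] \<delta> by simp
      qed
      then show "hausdorff_weight s (CA n) + hausdorff_weight s (CB n) \<le> hausdorff_weight s (C n)"
        by (auto simp: CA_def CB_def hausdorff_weight_empty[OF s])
    qed
    finally show "H \<delta> A + H \<delta> B \<le> ?m C" .
  qed
  have "H \<delta> A + H \<epsilon> B \<le> hausdorff_outer s (A \<union> B)" if "\<delta> > 0" "\<epsilon> > 0" for \<delta> \<epsilon>
  proof -
    define \<theta> where "\<theta> = min (min \<delta> \<epsilon>) (\<eta> / 2)"
    have \<theta>: "0 < \<theta>" "\<theta> < \<eta>" "\<theta> \<le> \<delta>" "\<theta> \<le> \<epsilon>"
      using that \<eta> by (auto simp: \<theta>_def)
    have "H \<delta> A + H \<epsilon> B \<le> H \<theta> A + H \<theta> B"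
      using \<theta> by (intro add_mono anti)
    also have "\<dots> \<le> H \<theta> (A \<union> B)"
      using \<theta> by (intro small)
    also have "\<dots> \<le> hausdorff_outer s (A \<union> B)"
      unfolding outer using \<theta> by (intro SUP_upper) auto
    finally show ?thesis .
  qed
  then have "H \<delta> A + hausdorff_outer s B \<le> hausdorff_outer s (A \<union> B)" if "\<delta> > 0" for \<delta>
    unfolding outer[of B] using that
    by (simp add: ennreal_SUP_add_right SUP_le_iff)
  then show ?thesis
    unfolding outer[of A]
    by (simp add: ennreal_SUP_add_left[symmetric] SUP_le_iff)
qed

lemma hausdorff_outer_separated_sum:
  fixes X :: "nat \<Rightarrow> 'a::metric_space set"
  assumes s: "s > 0"
    and sep: "\<And>n. \<exists>\<eta>>0. \<forall>m<n. \<forall>x\<in>X m. \<forall>y\<in>X n. \<eta> \<le> dist x y"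
  shows "(\<Sum>m<n. hausdorff_outer s (X m)) \<le> hausdorff_outer s (\<Union>m<n. X m)"
proof (induction n)
  case (Suc n)
  obtain \<eta> where \<eta>: "\<eta> > 0" "\<And>m x y. m < n \<Longrightarrow> x \<in> X m \<Longrightarrow> y \<in> X n \<Longrightarrow> \<eta> \<le> dist x y"
    using sep[of n] by blast
  have "(\<Sum>m<Suc n. hausdorff_outer s (X m)) \<le>
      hausdorff_outer s (\<Union>m<n. X m) + hausdorff_outer s (X n)"
    using Suc by (simp add: add_right_mono)
  also have "\<dots> \<le> hausdorff_outer s ((\<Union>m<n. X m) \<union> X n)"
    using \<eta> by (intro hausdorff_outer_separated[OF s \<eta>(1)]) auto
  finally show ?case
    by (simp add: lessThan_Suc Un_commute)
qed (simp add: hausdorff_outer_empty[OF s])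

lemma hausdorff_outer_closed_split:
  fixes F X :: "'a::metric_space set"
  assumes s: "s > 0" and F: "closed F"
  shows "hausdorff_outer s (X \<inter> F) + hausdorff_outer s (X - F) \<le> hausdorff_outer s X"
proof (cases "F = {} \<or> hausdorff_outer s X = top")
  case True
  then show ?thesis by (auto simp: hausdorff_outer_empty[OF s])
next
  case False
  let ?H = "hausdorff_outer s :: 'a set \<Rightarrow> ennreal"
  from False have ne: "F \<noteq> {}" and fin: "?H X \<noteq> top" by auto
  define Y where "Y = (\<lambda>n::nat. {x \<in> X. 1 / real (Suc n) \<le> infdist x F})"
  define R where "R = (\<lambda>n::nat. {x \<in> X. 1 / real (Suc (Suc n)) \<le> infdist x F \<and> infdist x F < 1 / real (Suc n)})"
  have sepR: "1 / real (Suc m) \<le> infdist x F \<Longrightarrow> infdist y F < 1 / real (Suc n) \<Longrightarrow>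
      1 / real (Suc m) - 1 / real (Suc n) \<le> dist x y" for m n x y
    using infdist_triangle[of x F y] by linarith
  have sep: "\<exists>\<eta>>0. \<forall>m<n. \<forall>x\<in>R (2 * m + c). \<forall>y\<in>R (2 * n + c). \<eta> \<le> dist x y" for n c
  proof (cases n)
    case 0
    then show ?thesis by (auto intro: exI[of _ 1])
  next
    case (Suc k)
    define \<eta> where "\<eta> = 1 / real (Suc (2 * n + c - 1)) - 1 / real (Suc (2 * n + c))"
    have "\<eta> > 0"
      unfolding \<eta>_def using Suc by (simp add: frac_less2)
    moreover have "\<eta> \<le> dist x y" if "m < n" "x \<in> R (2 * m + c)" "y \<in> R (2 * n + c)" for m x y
    proof -
      have "1 / real (Suc (2 * n + c - 1)) \<le> 1 / real (Suc (Suc (2 * m + c)))"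
        using that(1) by (intro divide_left_mono) auto
      also have "\<dots> \<le> infdist x F"
        using that(2) by (auto simp: R_def)
      finally show ?thesis
        unfolding \<eta>_def using that(3) by (intro sepR) (auto simp: R_def)
    qed
    ultimately show ?thesis by blast
  qed
  have half: "(\<Sum>m. ?H (R (2 * m + c))) \<le> ?H X" for c
  proof (intro suminf_le_const summableI)
    fix n
    have "(\<Sum>m<n. ?H (R (2 * m + c))) \<le> ?H (\<Union>m<n. R (2 * m + c))"
      by (intro hausdorff_outer_separated_sum[OF s] sep)
    also have "\<dots> \<le> ?H X"
      by (intro hausdorff_outer_mono) (auto simp: R_def)
    finally show "(\<Sum>m<n. ?H (R (2 * m + c))) \<le> ?H X" .
  qed
  have total: "(\<Sum>m. ?H (R m)) \<le> ?H X + ?H X"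
  proof (intro suminf_le_const summableI)
    fix n
    have "(\<Sum>m<n. ?H (R m)) \<le> (\<Sum>m<2 * n. ?H (R m))"
      by (intro sum_mono2) auto
    also have "\<dots> = (\<Sum>m<n. ?H (R (2 * m + 0))) + (\<Sum>m<n. ?H (R (2 * m + 1)))"
      by (induction n) (auto simp: algebra_simps)
    also have "\<dots> \<le> (\<Sum>m. ?H (R (2 * m + 0))) + (\<Sum>m. ?H (R (2 * m + 1)))"
      by (intro add_mono sum_le_suminf summableI) auto
    also have "\<dots> \<le> ?H X + ?H X"
      by (intro add_mono half)
    finally show "(\<Sum>m<n. ?H (R m)) \<le> ?H X + ?H X" .
  qed
  have YF: "?H (X \<inter> F) + ?H (Y n) \<le> ?H X" for n
  proof -
    have "?H (X \<inter> F) + ?H (Y n) \<le> ?H ((X \<inter> F) \<union> Y n)"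
    proof (rule hausdorff_outer_separated[OF s])
      show "0 < 1 / real (Suc n)" by simp
      show "1 / real (Suc n) \<le> dist x y" if "x \<in> X \<inter> F" "y \<in> Y n" for x y
        using infdist_le[of x F y] that by (auto simp: Y_def dist_commute)
    qed
    also have "\<dots> \<le> ?H X"
      by (intro hausdorff_outer_mono) (auto simp: Y_def)
    finally show ?thesis .
  qed
  have tail: "?H (X - F) \<le> ?H (Y n) + (\<Sum>m. ?H (R (m + n)))" for n
  proof -
    have "X - F \<subseteq> Y n \<union> (\<Union>m. R (m + n))"
    proof
      fix x assume x: "x \<in> X - F"
      have pos: "infdist x F > 0"
        using x ne F in_closed_iff_infdist_zero[of F x] infdist_nonneg[of x F] by force
      show "x \<in> Y n \<union> (\<Union>m. R (m + n))"
      proof (cases "1 / real (Suc n) \<le> infdist x F")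
        case True
        then show ?thesis using x by (auto simp: Y_def)
      next
        case lt: False
        define P where "P = (\<lambda>k::nat. 1 / real (Suc k) \<le> infdist x F)"
        obtain k0 where "P k0"
          using nat_approx_posE[OF pos] unfolding P_def by (metis less_imp_le)
        define k where "k = (LEAST k. P k)"
        have Pk: "P k" and least: "\<And>j. j < k \<Longrightarrow> \<not> P j"
          using \<open>P k0\<close> by (auto simp: k_def intro: LeastI dest: not_less_Least)
        have "n < k"
        proof (rule ccontr)
          assume "\<not> n < k"
          then have "1 / real (Suc n) \<le> 1 / real (Suc k)"
            by (intro divide_left_mono) auto
          with Pk lt show False by (simp add: P_def)
        qed
        then obtain m where k: "k = Suc (m + n)"
          by (metis add.commute less_natE)
        have "x \<in> R (m + n)"
          using Pk least[of "m + n"] x by (auto simp: R_def P_def k)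
        then show ?thesis by blast
      qed
    qed
    then have "?H (X - F) \<le> ?H (Y n \<union> (\<Union>m. R (m + n)))"
      by (rule hausdorff_outer_mono)
    also have "\<dots> \<le> ?H (Y n) + ?H (\<Union>m. R (m + n))"
      by (rule hausdorff_outer_subadditive[OF s])
    also have "\<dots> \<le> ?H (Y n) + (\<Sum>m. ?H (R (m + n)))"
      by (intro add_left_mono hausdorff_outer_countable_subadditive)
    finally show ?thesis .
  qed
  have "(\<Sum>m. ?H (R m)) \<noteq> top"
    using total fin by (metis ennreal_add_eq_top top.extremum_uniqueI)
  then have lim: "(\<lambda>n. \<Sum>m. ?H (R (m + n))) \<longlonglongrightarrow> 0"
    by (rule ennreal_tail_lim)
  have "?H (X \<inter> F) + ?H (X - F) \<le> ?H X + (\<Sum>m. ?H (R (m + n)))" for n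
  proof -
    have "?H (X \<inter> F) + ?H (X - F) \<le> (?H (X \<inter> F) + ?H (Y n)) + (\<Sum>m. ?H (R (m + n)))"
      using add_left_mono[OF tail] by (simp add: add.assoc)
    also have "\<dots> \<le> ?H X + (\<Sum>m. ?H (R (m + n)))"
      by (intro add_right_mono YF)
    finally show ?thesis .
  qed
  moreover have "(\<lambda>n. ?H X + (\<Sum>m. ?H (R (m + n)))) \<longlonglongrightarrow> ?H X + 0"
    by (intro tendsto_add tendsto_const lim)
  ultimately show ?thesis
    using Lim_bounded2[of _ "?H X + 0" 0 "?H (X \<inter> F) + ?H (X - F)"] by simp
qed

lemma emeasure_hausdorff_measure:
  fixes A :: "'a::metric_space set"
  assumes s: "s > 0" and A: "A \<in> sets borel"
  shows "emeasure (hausdorff_measure s) A = hausdorff_outer s A"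
proof -
  let ?H = "hausdorff_outer s :: 'a set \<Rightarrow> ennreal"
  interpret P: sigma_algebra UNIV "UNIV :: 'a set set"
    using sigma_algebra_Pow[of "UNIV :: 'a set"] by simp
  let ?L = "lambda_system UNIV UNIV ?H"
  have "outer_measure_space UNIV ?H"
    by (auto simp: outer_measure_space_def positive_def increasing_def countably_subadditive_def
        hausdorff_outer_empty[OF s] intro: hausdorff_outer_mono hausdorff_outer_countable_subadditive)
  then have ms: "measure_space UNIV ?L ?H"
    by (rule P.caratheodory_lemma)
  then have L: "sigma_algebra UNIV ?L"
    by (simp add: measure_space_def)
  have "F \<in> ?L" if "closed F" for F
  proof -
    have "?H (X \<inter> F) + ?H (X - F) = ?H X" for X
      using hausdorff_outer_closed_split[OF s that, of X]
        hausdorff_outer_subadditive[OF s, of "X \<inter> F" "X - F"]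
      by (simp add: Int_Diff_Un antisym)
    then show ?thesis
      by (simp add: P.lambda_system_eq)
  qed
  then have "sigma_sets UNIV (Collect closed) \<subseteq> ?L"
    using sigma_algebra.sigma_sets_subset[OF L, of "Collect closed"] by auto
  then have sub: "sets borel \<subseteq> ?L"
    by (simp add: borel_eq_closed)
  have "measure_space UNIV (sets borel) ?H"
    using sets.sigma_algebra_axioms[of "borel :: 'a measure"] sub
    by (intro measure_down[OF ms]) auto
  then have "positive (sets borel) ?H" "countably_additive (sets borel) ?H"
    by (auto simp: measure_space_def)
  then show ?thesis
    unfolding hausdorff_measure_def
    using sets.sigma_algebra_axioms[of "borel :: 'a measure"] A
    by (intro emeasure_measure_of_sigma) auto
qed

lemma sets_hausdorff_measure: "sets (hausdorff_measure s) = sets borel"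
  unfolding hausdorff_measure_def by (metis sets.sigma_algebra_axioms space_borel sigma_algebra.sets_measure_of_eq)

definition surface_measure :: "(real ^ 'd) measure" where
  "surface_measure = hausdorff_measure (CARD('d) - 1)"

datatype element_type = Simplicial | Cubical

text \<open>Triangles and tetrahedra are \<^const>\<open>Simplicial\<close>, quadrilaterals and hexahedra are
  \<^const>\<open>Cubical\<close>.\<close>

fun reference_element :: "element_type \<Rightarrow> (real ^ 'd) set" where
  "reference_element Simplicial = convex hull (insert 0 Basis)"
| "reference_element Cubical = cbox 0 1"

fun shape_functions :: "element_type \<Rightarrow> (real ^ 'd \<Rightarrow> real) set" where
  "shape_functions Simplicial = {\<lambda>\<xi>. c + a \<bullet> \<xi> | c a. True}"
| "shape_functions Cubical = {\<lambda>\<xi>. \<Sum>S\<in>UNIV. c S * (\<Prod>i\<in>S. \<xi> $ i) | c :: 'd set \<Rightarrow> real. True}"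

text \<open>A mesh element \<open>E\<close> is represented by its reference map \<open>\<Phi>\<close>, with
  \<open>E = \<Phi> ` reference_element ty\<close>. The map is affine for simplices and (componentwise)
  multilinear for quadrilaterals and hexahedra; it is injective with nowhere singular
  derivative on the closed reference element. As usual for finite elements, the (multi)linear
  functions on \<open>E\<close> are the functions \<open>w \<circ> \<Phi>\<inverse>\<close> with \<open>w\<close> (multi)linear on the reference element;
  for simplices and for axis-aligned boxes these are the functions that are (multi)linear
  in the coordinates of \<open>E\<close> itself.\<close>

definition reference_map :: "element_type \<Rightarrow> (real ^ 'd \<Rightarrow> real ^ 'd) \<Rightarrow> bool" where
  "reference_map ty \<Phi> \<longleftrightarrow>
     (\<forall>i. (\<lambda>\<xi>. \<Phi> \<xi> $ i) \<in> shape_functions ty) \<and>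
     inj_on \<Phi> (reference_element ty) \<and>
     (\<forall>\<xi>\<in>reference_element ty. inj (frechet_derivative \<Phi> (at \<xi>)))"

definition is_mesh ::
  "element_type \<Rightarrow> (real ^ 'd) set \<Rightarrow> (real ^ 'd \<Rightarrow> real ^ 'd) set \<Rightarrow> bool" where
  "is_mesh ty \<Omega> \<T> \<longleftrightarrow>
     finite \<T> \<and> (\<forall>\<Phi>\<in>\<T>. reference_map ty \<Phi>) \<and>
     (\<Union>\<Phi>\<in>\<T>. \<Phi> ` reference_element ty) = closure \<Omega> \<and>
     (\<forall>\<Phi>\<in>\<T>. \<forall>\<Psi>\<in>\<T>. \<Phi> \<noteq> \<Psi> \<longrightarrow>
        interior (\<Phi> ` reference_element ty) \<inter> interior (\<Psi> ` reference_element ty) = {})"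

definition mesh_vertices ::
  "element_type \<Rightarrow> (real ^ 'd \<Rightarrow> real ^ 'd) set \<Rightarrow> (real ^ 'd) set" where
  "mesh_vertices ty \<T> = (\<Union>\<Phi>\<in>\<T>. \<Phi> ` {\<xi>. \<xi> extreme_point_of reference_element ty})"

text \<open>The edges and faces of the reference element: all its proper faces except the vertices.\<close>

definition reference_sides :: "element_type \<Rightarrow> (real ^ 'd) set set" where
  "reference_sides ty =
     {F. F face_of reference_element ty \<and> 1 \<le> aff_dim F \<and> aff_dim F < int CARD('d)}"

definition side_center :: "(real ^ 'd) set \<Rightarrow> real ^ 'd" where
  "side_center F =
     (let V = {\<xi>. \<xi> extreme_point_of F} in (1 / real (card V)) *\<^sub>R (\<Sum>\<xi>\<in>V. \<xi>))"

definition hanging_vertices ::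
  "element_type \<Rightarrow> (real ^ 'd \<Rightarrow> real ^ 'd) set \<Rightarrow> (real ^ 'd) set" where
  "hanging_vertices ty \<T> =
     {x \<in> mesh_vertices ty \<T>. \<exists>\<Phi>\<in>\<T>. \<exists>F\<in>reference_sides ty. x \<in> \<Phi> ` rel_interior F}"

definition regular_vertices ::
  "element_type \<Rightarrow> (real ^ 'd \<Rightarrow> real ^ 'd) set \<Rightarrow> (real ^ 'd) set" where
  "regular_vertices ty \<T> = mesh_vertices ty \<T> - hanging_vertices ty \<T>"

definition one_irregular :: "element_type \<Rightarrow> (real ^ 'd \<Rightarrow> real ^ 'd) set \<Rightarrow> bool" where
  "one_irregular ty \<T> \<longleftrightarrow>
     (\<forall>\<Phi>\<in>\<T>. \<forall>F\<in>reference_sides ty.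
        mesh_vertices ty \<T> \<inter> \<Phi> ` rel_interior F \<subseteq> {\<Phi> (side_center F)})"

text \<open>Functions on the closure of \<open>\<Omega>\<close> are extended by zero, so that equality of discrete functions
  is equality in HOL.\<close>

definition fe_space ::
  "element_type \<Rightarrow> (real ^ 'd) set \<Rightarrow> (real ^ 'd \<Rightarrow> real ^ 'd) set \<Rightarrow> (real ^ 'd \<Rightarrow> real) set" where
  "fe_space ty \<Omega> \<T> =
     {v. continuous_on (closure \<Omega>) v \<and>
         (\<forall>\<Phi>\<in>\<T>. \<exists>w\<in>shape_functions ty. \<forall>\<xi>\<in>reference_element ty. v (\<Phi> \<xi>) = w \<xi>) \<and>
         (\<forall>x. x \<notin> closure \<Omega> \<longrightarrow> v x = 0)}"

text \<open>There is no vector space instance for functions of type \<^typ>\<open>'a \<Rightarrow> real\<close> in the library.\<close>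

definition fun_span :: "('i \<Rightarrow> 'a \<Rightarrow> real) \<Rightarrow> 'i set \<Rightarrow> ('a \<Rightarrow> real) set" where
  "fun_span N I = {\<lambda>x. \<Sum>i\<in>I. c i * N i x | c. True}"

definition with_boundary_values ::
  "('a \<Rightarrow> real) set \<Rightarrow> 'a set \<Rightarrow> ('a \<Rightarrow> real) \<Rightarrow> ('a \<Rightarrow> real) set" where
  "with_boundary_values S \<Gamma> g = {v \<in> S. \<forall>x\<in>\<Gamma>. v x = g x}"

text \<open>The regular vertices serve as their own indices.\<close>

definition lagrange_basis ::
  "(real ^ 'd \<Rightarrow> real ^ 'd \<Rightarrow> real) \<Rightarrow> (real ^ 'd) set \<Rightarrow> (real ^ 'd \<Rightarrow> real) set \<Rightarrow> bool" where
  "lagrange_basis N J S \<longleftrightarrow>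
     (\<forall>i\<in>J. N i \<in> S \<and> (\<forall>j\<in>J. N i j = (if i = j then 1 else 0))) \<and> S = fun_span N J"

definition interface_nodes ::
  "(real ^ 'd \<Rightarrow> real ^ 'd \<Rightarrow> real) \<Rightarrow> (real ^ 'd) set \<Rightarrow> (real ^ 'd) set \<Rightarrow> (real ^ 'd) set" where
  "interface_nodes N J L =
     {i \<in> J. emeasure surface_measure (closure {x. N i x \<noteq> 0} \<inter> L) > 0}"

text \<open>Discrete functions are differentiable in the interior of every element, hence almost
  everywhere.\<close>

definition grad :: "('a::real_inner \<Rightarrow> real) \<Rightarrow> 'a \<Rightarrow> 'a" where
  "grad v x = (THE D. GDERIV v x :> D)"

definition flow_form ::
  "(real ^ 'd \<Rightarrow> real) \<Rightarrow> (real ^ 'd) set \<Rightarrow> (real ^ 'd \<Rightarrow> real) \<Rightarrow> (real ^ 'd \<Rightarrow> real) \<Rightarrow> real" where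
  "flow_form k A p v = (LINT x|lebesgue_on A. k x * (grad p x \<bullet> grad v x))"

definition surface_inner ::
  "(real ^ 'd) set \<Rightarrow> (real ^ 'd \<Rightarrow> real) \<Rightarrow> (real ^ 'd \<Rightarrow> real) \<Rightarrow> real" where
  "surface_inner \<Gamma> u v = (LINT x:\<Gamma>|surface_measure. u x * v x)"

definition surface_square_integrable :: "(real ^ 'd) set \<Rightarrow> (real ^ 'd \<Rightarrow> real) \<Rightarrow> bool" where
  "surface_square_integrable \<Gamma> u \<longleftrightarrow>
     set_borel_measurable surface_measure \<Gamma> u \<and>
     set_integrable surface_measure \<Gamma> (\<lambda>x. (u x)\<^sup>2)"

definition boundary_decomposition ::
  "(real ^ 'd) set \<Rightarrow> (real ^ 'd) set \<Rightarrow> (real ^ 'd) set \<Rightarrow> bool" where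
  "boundary_decomposition \<Omega> \<Gamma>D \<Gamma>N \<longleftrightarrow>
     \<Gamma>D \<in> sets borel \<and> \<Gamma>N \<in> sets borel \<and>
     frontier \<Omega> = closure \<Gamma>D \<union> closure \<Gamma>N \<and>
     (top_of_set (frontier \<Omega>) interior_of \<Gamma>D) \<inter> (top_of_set (frontier \<Omega>) interior_of \<Gamma>N) = {}"

definition finite_union_of_boxes :: "(real ^ 'd) set \<Rightarrow> bool" where
  "finite_union_of_boxes A \<longleftrightarrow>
     (\<exists>\<B>. finite \<B> \<and> A = \<Union>\<B> \<and> (\<forall>B\<in>\<B>. \<exists>a b. box a b \<noteq> {} \<and> (B = box a b \<or> B = cbox a b)))"

text \<open>Two non-overlapping open subdomains that fill \<open>\<Omega>\<close>. The last two conditions are the regularity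
  that integration over \<open>\<Gamma>\<^sub>1\<close>, \<open>\<Gamma>\<^sub>2\<close> and \<open>L\<close> presupposes, and they hold for Lipschitz and for
  polyhedral subdomains: the boundaries have finite surface measure, and the interface meets the
  Neumann boundary in a surface-null set only, so that the decompositions of \<open>\<Gamma>\<^sub>1\<close> and \<open>\<Gamma>\<^sub>2\<close> into
  \<open>L\<close> and pieces of the Neumann boundary do not overlap.\<close>

definition subdomain_pair ::
  "(real ^ 'd) set \<Rightarrow> (real ^ 'd) set \<Rightarrow> (real ^ 'd) set \<Rightarrow> (real ^ 'd) set \<Rightarrow> bool" where
  "subdomain_pair \<Omega> \<Gamma>N \<Omega>1 \<Omega>2 \<longleftrightarrow>
     open \<Omega>1 \<and> open \<Omega>2 \<and> \<Omega>1 \<subseteq> \<Omega> \<and> \<Omega>2 \<subseteq> \<Omega> \<and> \<Omega>1 \<inter> \<Omega>2 = {} \<and>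
     closure \<Omega>1 \<union> closure \<Omega>2 = closure \<Omega> \<and>
     emeasure surface_measure (frontier \<Omega>1) < \<infinity> \<and>
     emeasure surface_measure (frontier \<Omega>2) < \<infinity> \<and>
     emeasure surface_measure (frontier \<Omega>1 \<inter> frontier \<Omega>2 \<inter> \<Gamma>N) = 0"

end

theory Submission
  imports Defs
begin

text \<open>Both claims come from choosing test functions. The constant function \<open>1\<close> belongs to \<open>S\<^sup>h\<close> and
  has zero gradient, so testing the two flux equations with it leaves only the surface terms; these
  are the two balances in (i). Functions are extended by zero, so the constant function is the indicator of
  the closed domain (\<open>indicator_in_fe_space\<close>, \<open>flow_form_indicator\<close>).

  For (ii), Galerkin's equation on \<open>V\<^sup>h\<close> and the definition of the boundary flux on \<open>G\<^sup>h\<close> combine,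
  since \<open>S\<^sup>h = V\<^sup>h + G\<^sup>h\<close> and functions in \<open>V\<^sup>h\<close> vanish on \<open>\<Gamma>\<^sub>D\<close>, to
  \<open>d(p, v) - f(v) = (q\<^sub>D, v)\<close> over \<open>\<Gamma>\<^sub>D\<close> for every \<open>v\<close> in \<open>S\<^sup>h\<close>. Adding the two flux equations and
  using \<open>d\<^sub>1 + d\<^sub>2 = d\<close> and \<open>f\<^sub>1 + f\<^sub>2 = f\<close> turns the sum of the interface pairings into
  \<open>d(p, v) - f(v) - (q\<^sub>D, v) = 0\<close>.

  The analytic content lies in the additivity of \<open>d\<close> and \<open>f\<close>. Additivity in the test function needs
  integrability: gradients of discrete functions exist and are bounded off a null set, by the inverse
  function theorem and compactness of the reference element (\<open>gradient_of_pullback_bounded\<close>), and they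
  are measurable as limits of difference quotients (\<open>borel_measurable_grad\<close>); on the surface,
  discrete functions are bounded and the boundaries have finite measure. Additivity in the domain
  needs that the boundaries of the subdomains are Lebesgue null, which follows from their finite
  surface measure (\<open>finite_hausdorff_outer_imp_negligible\<close>), and that the two pieces of the Neumann
  boundary overlap in a surface-null set only.\<close>

section \<open>Finite surface measure and Lebesgue null sets\<close>

text \<open>A set covered by sets of diameters \<open>d\<^sub>n \<le> \<delta>\<close> is covered by balls of radii \<open>d\<^sub>n\<close>, whose
  total volume is of order \<open>\<Sum>n. d\<^sub>n ^ (s + 1) \<le> \<delta> * (\<Sum>n. d\<^sub>n ^ s)\<close>. The last sum stays bounded
  while \<open>\<delta>\<close> tends to zero.\<close>
lemma finite_hausdorff_outer_imp_negligible:
  fixes A :: "'a::euclidean_space set"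
  assumes dim: "DIM('a) = Suc s" and fin: "hausdorff_outer s A < \<infinity>"
  shows "negligible A"
  unfolding negligible_outer_le
proof (intro allI impI)
  fix e :: real assume e: "e > 0"
  obtain M where M: "M > 0" "hausdorff_outer s A < ennreal M"
  proof -
    obtain r where "r \<ge> 0" "hausdorff_outer s A = ennreal r"
      using fin by (cases "hausdorff_outer s A") auto
    then show ?thesis
      using that[of "r + 1"] by (simp add: ennreal_lessI)
  qed
  \<comment> \<open>\<open>\<kappa>\<close> converts \<open>\<delta>\<close> times the Hausdorff weight of a set of diameter at most \<open>\<delta>\<close> into a
    bound for the volume of the ball around it; \<open>\<delta>\<close> makes the total volume \<open>\<kappa> * \<delta> * M = e\<close>.\<close>
  define \<kappa> where "\<kappa> = unit_ball_vol (real (Suc s)) * 2 ^ s / unit_ball_vol (real s)"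
  have \<kappa>: "\<kappa> > 0"
    by (simp add: \<kappa>_def)
  define \<delta> where "\<delta> = e / (\<kappa> * M)"
  have \<delta>: "\<delta> > 0"
    using e M \<kappa> by (simp add: \<delta>_def)
  have "(INF C\<in>hausdorff_cover \<delta> A. \<Sum>n. hausdorff_weight s (C n)) \<le> hausdorff_outer s A"
    unfolding hausdorff_outer_def using \<delta> by (intro SUP_upper) auto
  then have "(INF C\<in>hausdorff_cover \<delta> A. \<Sum>n. hausdorff_weight s (C n)) < ennreal M"
    using M(2) by (rule le_less_trans)
  then obtain C where cover: "C \<in> hausdorff_cover \<delta> A"
      and weight: "(\<Sum>n. hausdorff_weight s (C n)) < ennreal M"
    by (auto simp: INF_less_iff)
  define T where "T = (\<lambda>n. cball (SOME x. x \<in> C n) (diameter (C n)))"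
  have C: "bounded (C n)" "diameter (C n) \<le> \<delta>" for n
    using cover by (auto simp: hausdorff_cover_def)
  have "C n \<subseteq> T n" for n
  proof
    fix y assume y: "y \<in> C n"
    then have "(SOME x. x \<in> C n) \<in> C n"
      by (rule someI)
    then show "y \<in> T n"
      using diameter_bounded_bound[OF C(1) _ y] by (simp add: T_def)
  qed
  then have sub: "A \<subseteq> (\<Union>n. T n)"
    using cover by (fastforce simp: hausdorff_cover_def)
  have T: "emeasure lborel (T n) \<le> ennreal (\<kappa> * \<delta>) * hausdorff_weight s (C n)" for n
  proof -
    let ?d = "diameter (C n)"
    have d: "0 \<le> ?d"
      using C by (simp add: diameter_ge_0)
    have "unit_ball_vol (real (Suc s)) * ?d ^ Suc s
        \<le> unit_ball_vol (real (Suc s)) * (\<delta> * ?d ^ s)"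
      using C(2)[of n] d by (intro mult_left_mono) (auto intro!: mult_right_mono)
    also have "\<dots> = \<kappa> * \<delta> * (unit_ball_vol (real s) * (?d / 2) ^ s)"
      by (simp add: \<kappa>_def power_divide less_imp_neq[OF unit_ball_vol_pos, symmetric])
    finally show ?thesis
      unfolding T_def hausdorff_weight_def
      using d \<kappa> \<delta> by (simp add: emeasure_cball dim ennreal_mult[symmetric] del: of_nat_Suc power_Suc)
  qed
  have meas: "T n \<in> sets lborel" for n
    by (simp add: T_def)
  have "emeasure lborel (\<Union>n. T n) \<le> (\<Sum>n. emeasure lborel (T n))"
    using meas by (intro emeasure_subadditive_countably) auto
  also have "\<dots> \<le> (\<Sum>n. ennreal (\<kappa> * \<delta>) * hausdorff_weight s (C n))"
    by (intro suminf_le T summableI)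
  also have "\<dots> = ennreal (\<kappa> * \<delta>) * (\<Sum>n. hausdorff_weight s (C n))"
    by (rule ennreal_suminf_cmult)
  also have "\<dots> \<le> ennreal (\<kappa> * \<delta>) * ennreal M"
    using weight by (intro mult_left_mono) auto
  also have "\<dots> = ennreal (\<kappa> * \<delta> * M)"
    using M \<kappa> \<delta> by (simp add: ennreal_mult[symmetric])
  also have "\<kappa> * \<delta> * M = e"
    using M \<kappa> by (simp add: \<delta>_def)
  finally have le: "emeasure lborel (\<Union>n. T n) \<le> ennreal e" .
  have sets: "(\<Union>n. T n) \<in> sets borel"
    using meas by simp
  have em: "emeasure lebesgue (\<Union>n. T n) \<le> ennreal e"
    using le sets by simp
  have "(\<Union>n. T n) \<in> lmeasurable"
    using em sets by (auto simp: fmeasurable_def intro: le_less_trans)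
  moreover have "measure lebesgue (\<Union>n. T n) \<le> e"
    using em e by (simp add: measure_def enn2real_leI)
  ultimately show "\<exists>T. A \<subseteq> T \<and> T \<in> lmeasurable \<and> measure lebesgue T \<le> e"
    using sub by blast
qed

lemma sets_surface_measure [simp, measurable_cong]: "sets surface_measure = sets borel"
  by (simp add: surface_measure_def sets_hausdorff_measure)

lemma space_surface_measure [simp]: "space surface_measure = UNIV"
  using sets_eq_imp_space_eq[OF sets_surface_measure] by simp

lemma finite_surface_measure_imp_negligible:
  fixes A :: "(real ^ 'd) set"
  assumes "CARD('d) \<ge> 2" "A \<in> sets borel" "emeasure surface_measure A < \<infinity>"
  shows "negligible A"
  using assms
  by (intro finite_hausdorff_outer_imp_negligible[of "CARD('d) - 1"])
     (auto simp: surface_measure_def emeasure_hausdorff_measure)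

section \<open>Gradients of discrete functions\<close>

text \<open>Continuity of the derivative jointly in the point and the direction is what the compactness
  arguments below use: it turns pointwise bounds for the differentials into uniform ones.\<close>
lemma shape_function_derivative:
  assumes "w \<in> shape_functions ty"
  shows "\<exists>w'. (\<forall>\<xi>. (w has_derivative w' \<xi>) (at \<xi>)) \<and>
    continuous_on UNIV (\<lambda>(\<xi>, \<eta>). w' \<xi> \<eta>)"
proof (cases ty)
  case Simplicial
  with assms obtain c a where w: "w = (\<lambda>\<xi>. c + a \<bullet> \<xi>)" by auto
  show ?thesis
    by (rule exI[of _ "\<lambda>\<xi> \<eta>. a \<bullet> \<eta>"])
       (auto simp: w case_prod_beta intro!: derivative_eq_intros continuous_intros)
next
  case Cubical
  with assms obtain c :: "'a set \<Rightarrow> real" where w: "w = (\<lambda>\<xi>. \<Sum>S\<in>UNIV. c S * (\<Prod>i\<in>S. \<xi> $ i))" by auto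
  define w' where "w' = (\<lambda>\<xi> \<eta> :: real ^ 'a. \<Sum>S\<in>UNIV. c S * (\<Sum>i\<in>S. \<eta> $ i * (\<Prod>j\<in>S - {i}. \<xi> $ j)))"
  show ?thesis
  proof (intro exI[of _ w'] conjI allI)
    show "(w has_derivative w' \<xi>) (at \<xi>)" for \<xi>
      unfolding w w'_def
      by (intro has_derivative_sum has_derivative_mult_right has_derivative_prod)
         (rule bounded_linear.has_derivative[OF bounded_linear_vec_nth has_derivative_ident])
    show "continuous_on UNIV (\<lambda>(\<xi>, \<eta>). w' \<xi> \<eta>)"
      unfolding w'_def case_prod_beta by (intro continuous_intros)
  qed
qed

lemma reference_map_derivative:
  assumes "reference_map ty \<Phi>"
  shows "\<exists>\<Phi>'. (\<forall>\<xi>. (\<Phi> has_derivative \<Phi>' \<xi>) (at \<xi>)) \<and>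
    continuous_on UNIV (\<lambda>(\<xi>, \<eta>). \<Phi>' \<xi> \<eta>) \<and>
    (\<forall>\<xi>\<in>reference_element ty. inj (\<Phi>' \<xi>))"
proof -
  have "\<exists>w'. (\<forall>\<xi>. ((\<lambda>\<xi>. \<Phi> \<xi> $ i) has_derivative w' \<xi>) (at \<xi>)) \<and>
      continuous_on UNIV (\<lambda>(\<xi>, \<eta>). w' \<xi> \<eta>)" for i
    using assms by (intro shape_function_derivative) (auto simp: reference_map_def)
  then obtain w' where w': "\<And>i \<xi>. ((\<lambda>\<xi>. \<Phi> \<xi> $ i) has_derivative w' i \<xi>) (at \<xi>)"
      "\<And>i. continuous_on UNIV (\<lambda>(\<xi>, \<eta>). w' i \<xi> \<eta>)"
    by metis
  have der: "(\<Phi> has_derivative (\<lambda>\<eta>. \<chi> i. w' i \<xi> \<eta>)) (at \<xi>)" for \<xi>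
    by (subst has_derivative_componentwise_within) (auto simp: Basis_vec_def inner_axis w')
  show ?thesis
  proof (intro exI[of _ "\<lambda>\<xi> \<eta>. \<chi> i. w' i \<xi> \<eta>"] conjI allI ballI der)
    show "continuous_on UNIV (\<lambda>(\<xi>, \<eta>). \<chi> i. w' i \<xi> \<eta>)"
      using w'(2) by (auto simp: case_prod_beta intro!: continuous_intros)
    show "inj (\<lambda>\<eta>. \<chi> i. w' i \<xi> \<eta>)" if "\<xi> \<in> reference_element ty" for \<xi>
    proof -
      have "inj (frechet_derivative \<Phi> (at \<xi>))"
        using assms that by (auto simp: reference_map_def)
      then show ?thesis
        by (simp only: frechet_derivative_at[OF der, symmetric])
    qed
  qed
qed

lemma compact_reference_element: "compact (reference_element ty)"
  by (cases ty) (auto intro!: finite_imp_compact_convex_hull)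

lemma convex_reference_element: "convex (reference_element ty)"
  by (cases ty) (auto simp: convex_box)

lemma uniform_bound_linear_family:
  fixes F :: "'a::euclidean_space \<Rightarrow> 'a \<Rightarrow> 'b::real_normed_vector"
  assumes R: "compact R" and cont: "continuous_on UNIV (\<lambda>(\<xi>, \<eta>). F \<xi> \<eta>)"
    and lin: "\<And>\<xi>. linear (F \<xi>)"
  obtains M where "M > 0" "\<And>\<xi> \<eta>. \<xi> \<in> R \<Longrightarrow> norm (F \<xi> \<eta>) \<le> M * norm \<eta>"
proof -
  have "compact ((\<lambda>(\<xi>, \<eta>). F \<xi> \<eta>) ` (R \<times> sphere 0 1))"
    by (intro compact_continuous_image continuous_on_subset[OF cont] compact_Times R) auto
  then obtain M where M: "M > 0" "\<And>\<xi> \<eta>. \<xi> \<in> R \<Longrightarrow> norm \<eta> = 1 \<Longrightarrow> norm (F \<xi> \<eta>) \<le> M"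
    by (fastforce dest!: compact_imp_bounded simp: bounded_pos)
  have "norm (F \<xi> \<eta>) \<le> M * norm \<eta>" if "\<xi> \<in> R" for \<xi> \<eta>
  proof (cases "\<eta> = 0")
    case False
    then have "norm (F \<xi> (\<eta> /\<^sub>R norm \<eta>)) \<le> M"
      using that by (intro M) auto
    then show ?thesis
      using False by (simp add: linear_cmul[OF lin] field_simps)
  qed (simp add: linear_0[OF lin])
  then show ?thesis
    using M(1) that by blast
qed

lemma uniform_lower_bound_linear_family:
  fixes F :: "'a::euclidean_space \<Rightarrow> 'a \<Rightarrow> 'b::real_normed_vector"
  assumes R: "compact R" and cont: "continuous_on UNIV (\<lambda>(\<xi>, \<eta>). F \<xi> \<eta>)"
    and lin: "\<And>\<xi>. linear (F \<xi>)" and inj: "\<And>\<xi>. \<xi> \<in> R \<Longrightarrow> inj (F \<xi>)"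
  obtains c where "c > 0" "\<And>\<xi> \<eta>. \<xi> \<in> R \<Longrightarrow> c * norm \<eta> \<le> norm (F \<xi> \<eta>)"
proof (cases "R = {}")
  case True
  then show ?thesis using that[of 1] by simp
next
  case False
  have ne: "R \<times> sphere (0::'a) 1 \<noteq> {}"
    using False by simp
  have "continuous_on (R \<times> sphere (0::'a) 1) (\<lambda>z. norm ((\<lambda>(\<xi>, \<eta>). F \<xi> \<eta>) z))"
    by (intro continuous_on_norm continuous_on_subset[OF cont]) auto
  from continuous_attains_inf[OF compact_Times[OF R compact_sphere] ne this]
  obtain \<xi>0 \<eta>0 where z: "\<xi>0 \<in> R" "norm \<eta>0 = 1"
    and min: "\<And>\<xi> \<eta>. \<xi> \<in> R \<Longrightarrow> norm \<eta> = 1 \<Longrightarrow> norm (F \<xi>0 \<eta>0) \<le> norm (F \<xi> \<eta>)"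
    by fastforce
  have "F \<xi>0 \<eta>0 \<noteq> 0"
    using z inj linear_injective_0[OF lin] by (metis norm_zero zero_neq_one)
  then have pos: "norm (F \<xi>0 \<eta>0) > 0" by simp
  have "norm (F \<xi>0 \<eta>0) * norm \<eta> \<le> norm (F \<xi> \<eta>)" if "\<xi> \<in> R" for \<xi> \<eta>
  proof (cases "\<eta> = 0")
    case False
    then have "norm (F \<xi>0 \<eta>0) \<le> norm (F \<xi> (\<eta> /\<^sub>R norm \<eta>))"
      using that by (intro min) auto
    then show ?thesis
      using False by (simp add: linear_cmul[OF lin] field_simps)
  qed simp
  then show ?thesis
    using pos that by blast
qed

text \<open>On an element, \<open>v = w \<circ> \<Phi>\<inverse>\<close>, hence \<open>v\<close> has at \<open>\<Phi> \<xi>\<close> the differential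
  \<open>w' \<xi> \<circ> (\<Phi>' \<xi>)\<inverse>\<close>. Since \<open>R\<close> is compact, \<open>\<Phi>'\<close> stretches all directions at least by a constant
  \<open>c > 0\<close> and \<open>w'\<close> is bounded by a constant \<open>M\<close>, so that the gradient is bounded by \<open>M / c\<close>.\<close>
lemma gradient_of_pullback_bounded:
  fixes \<Phi> :: "'a::euclidean_space \<Rightarrow> 'a" and v w :: "'a \<Rightarrow> real"
  assumes R: "compact R"
    and \<Phi>: "\<And>\<xi>. (\<Phi> has_derivative \<Phi>' \<xi>) (at \<xi>)" "continuous_on UNIV (\<lambda>(\<xi>, \<eta>). \<Phi>' \<xi> \<eta>)"
    and inj: "inj_on \<Phi> R" "\<And>\<xi>. \<xi> \<in> R \<Longrightarrow> inj (\<Phi>' \<xi>)"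
    and w: "\<And>\<xi>. (w has_derivative w' \<xi>) (at \<xi>)" "continuous_on UNIV (\<lambda>(\<xi>, \<eta>). w' \<xi> \<eta>)"
    and v: "\<And>\<xi>. \<xi> \<in> R \<Longrightarrow> v (\<Phi> \<xi>) = w \<xi>"
  shows "\<exists>B. \<forall>\<xi>\<in>interior R. \<exists>D. GDERIV v (\<Phi> \<xi>) :> D \<and> norm D \<le> B"
proof -
  have lin\<Phi>: "linear (\<Phi>' \<xi>)" and linw: "linear (w' \<xi>)" for \<xi>
    using \<Phi>(1) w(1) has_derivative_linear by blast+
  obtain c where c: "c > 0" "\<And>\<xi> \<eta>. \<xi> \<in> R \<Longrightarrow> c * norm \<eta> \<le> norm (\<Phi>' \<xi> \<eta>)"
    using uniform_lower_bound_linear_family[OF R \<Phi>(2) lin\<Phi> inj(2)] by blast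
  obtain M where M: "M > 0" "\<And>\<xi> \<eta>. \<xi> \<in> R \<Longrightarrow> norm (w' \<xi> \<eta>) \<le> M * norm \<eta>"
    using uniform_bound_linear_family[OF R w(2) linw] by blast
  have "\<exists>D. GDERIV v (\<Phi> \<xi>) :> D \<and> norm D \<le> M / c" if \<xi>: "\<xi> \<in> interior R" for \<xi>
  proof -
    have \<xi>R: "\<xi> \<in> R"
      using \<xi> interior_subset by blast
    obtain A where A: "linear A" "\<And>x. A (\<Phi>' \<xi> x) = x" "\<And>x. \<Phi>' \<xi> (A x) = x"
      using linear_injective_isomorphism[OF lin\<Phi> inj(2)[OF \<xi>R]] by blast
    define g where "g = inv_into R \<Phi>"
    have cont: "continuous_on X \<Phi>" for X
      using \<Phi>(1) by (meson has_derivative_continuous continuous_at_imp_continuous_on)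
    have g: "g (\<Phi> \<zeta>) = \<zeta>" if "\<zeta> \<in> R" for \<zeta>
      using that inj(1) by (simp add: g_def)
    have dg: "(g has_derivative A) (at (\<Phi> \<xi>))"
      using \<xi> interior_subset[of R]
      by (intro has_derivative_inverse_strong[OF open_interior[of R] _ cont _ \<Phi>(1)])
         (auto simp: g A o_def)
    have "open (\<Phi> ` interior R)"
      using inj(1) interior_subset
      by (intro invariance_of_domain cont) (auto intro: inj_on_subset)
    moreover have "((\<lambda>x. w (g x)) has_derivative (\<lambda>h. w' \<xi> (A h))) (at (\<Phi> \<xi>))"
      using has_derivative_compose[OF dg, of w "w' \<xi>"] w(1) g[OF \<xi>R] by simp
    ultimately have dv: "(v has_derivative (\<lambda>h. w' \<xi> (A h))) (at (\<Phi> \<xi>))"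
      using \<xi> interior_subset[of R] g v
      by (elim has_derivative_transform_within_open) (auto simp: subset_iff)
    define D where "D = adjoint (\<lambda>h. w' \<xi> (A h)) 1"
    have D: "w' \<xi> (A h) = h \<bullet> D" for h
      using adjoint_works[of "\<lambda>h. w' \<xi> (A h)" h 1] linear_compose[OF A(1) linw[of \<xi>]]
      by (simp add: D_def o_def)
    have "GDERIV v (\<Phi> \<xi>) :> D"
      using dv by (simp add: gderiv_def D)
    moreover have "norm D \<le> M / c"
    proof -
      have "norm D * norm D = w' \<xi> (A D)"
        by (simp add: D norm_eq_sqrt_inner)
      also have "\<dots> \<le> M * norm (A D)"
        using M(2)[OF \<xi>R, of "A D"] by simp
      also have "\<dots> \<le> M * (norm D / c)"
        using c(2)[OF \<xi>R, of "A D"] c(1) M(1) by (simp add: A field_simps)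
      finally have "norm D * norm D \<le> (M / c) * norm D"
        by simp
      then show ?thesis
        using M(1) c(1) by (cases "D = 0") (simp_all only: mult_le_cancel_right norm_zero, simp_all)
    qed
    ultimately show ?thesis by blast
  qed
  then show ?thesis by blast
qed

definition element_interiors ::
  "element_type \<Rightarrow> (real ^ 'd \<Rightarrow> real ^ 'd) set \<Rightarrow> (real ^ 'd) set" where
  "element_interiors ty \<T> = (\<Union>\<Phi>\<in>\<T>. \<Phi> ` interior (reference_element ty))"

lemma reference_map_differentiable_on:
  assumes "reference_map ty \<Phi>"
  shows "\<Phi> differentiable_on X"
proof -
  obtain \<Phi>' where "\<And>\<xi>. (\<Phi> has_derivative \<Phi>' \<xi>) (at \<xi>)"
    using reference_map_derivative[OF assms] by blast
  then show ?thesis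
    by (intro differentiable_at_imp_differentiable_on differentiableI)
qed

lemma open_element_interiors:
  assumes "is_mesh ty \<Omega> \<T>"
  shows "open (element_interiors ty \<T>)"
  unfolding element_interiors_def
proof (intro open_UN ballI invariance_of_domain)
  fix \<Phi> assume "\<Phi> \<in> \<T>"
  then have \<Phi>: "reference_map ty \<Phi>"
    using assms by (auto simp: is_mesh_def)
  then show "continuous_on (interior (reference_element ty)) \<Phi>"
    by (intro differentiable_imp_continuous_on reference_map_differentiable_on)
  show "inj_on \<Phi> (interior (reference_element ty))"
    using \<Phi> by (intro inj_on_subset[OF _ interior_subset]) (simp add: reference_map_def)
qed simp

text \<open>What remains of the elements are the images of the frontier of the reference element, which is
  null because the reference element is convex; differentiable maps preserve null sets.\<close>
lemma negligible_off_element_interiors: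
  assumes mesh: "is_mesh ty \<Omega> \<T>"
  shows "negligible (closure \<Omega> - element_interiors ty \<T>)"
proof (rule negligible_subset)
  let ?R = "reference_element ty :: (real ^ 'a) set"
  show "negligible (\<Union>\<Phi>\<in>\<T>. \<Phi> ` frontier ?R)"
  proof (intro negligible_Union)
    show "finite ((\<lambda>\<Phi>. \<Phi> ` frontier ?R) ` \<T>)"
      using mesh by (simp add: is_mesh_def)
    fix X assume "X \<in> (\<lambda>\<Phi>. \<Phi> ` frontier ?R) ` \<T>"
    then obtain \<Phi> where "X = \<Phi> ` frontier ?R" "reference_map ty \<Phi>"
      using mesh by (auto simp: is_mesh_def)
    then show "negligible X"
      by (auto intro!: negligible_differentiable_image_negligible negligible_convex_frontier
            convex_reference_element reference_map_differentiable_on order_refl)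
  qed
  show "closure \<Omega> - element_interiors ty \<T> \<subseteq> (\<Union>\<Phi>\<in>\<T>. \<Phi> ` frontier ?R)"
  proof
    fix x assume x: "x \<in> closure \<Omega> - element_interiors ty \<T>"
    then have "x \<in> (\<Union>\<Phi>\<in>\<T>. \<Phi> ` ?R)"
      using mesh by (simp add: is_mesh_def)
    then obtain \<Phi> \<xi> where "\<Phi> \<in> \<T>" "\<xi> \<in> ?R" "x = \<Phi> \<xi>"
      by blast
    moreover from this x have "\<xi> \<notin> interior ?R"
      by (auto simp: element_interiors_def)
    ultimately show "x \<in> (\<Union>\<Phi>\<in>\<T>. \<Phi> ` frontier ?R)"
      using closure_subset[of ?R] unfolding frontier_def by blast
  qed
qed

lemma grad_eqI:
  assumes "GDERIV v x :> D"
  shows "grad v x = D"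
  unfolding grad_def
proof (rule the_equality)
  show "GDERIV v x :> D" by fact
  fix E assume "GDERIV v x :> E"
  with assms have "(\<lambda>h. h \<bullet> E) = (\<lambda>h. h \<bullet> D)"
    by (intro has_derivative_unique) (simp_all add: gderiv_def)
  then have "\<forall>h. h \<bullet> E = h \<bullet> D"
    by (simp add: fun_eq_iff)
  then show "E = D"
    by (simp only: vector_eq_ldot)
qed

lemma fe_space_gradient:
  assumes mesh: "is_mesh ty \<Omega> \<T>" and v: "v \<in> fe_space ty \<Omega> \<T>"
  obtains B where "\<And>x. x \<in> element_interiors ty \<T> \<Longrightarrow> GDERIV v x :> grad v x"
    and "\<And>x. x \<in> element_interiors ty \<T> \<Longrightarrow> norm (grad v x) \<le> B"
proof -
  let ?R = "reference_element ty"
  have "\<exists>B. \<forall>\<xi>\<in>interior ?R. \<exists>D. GDERIV v (\<Phi> \<xi>) :> D \<and> norm D \<le> B" if \<Phi>: "\<Phi> \<in> \<T>" for \<Phi>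
  proof -
    have ref: "reference_map ty \<Phi>"
      using mesh \<Phi> by (simp add: is_mesh_def)
    obtain \<Phi>' where \<Phi>': "\<And>\<xi>. (\<Phi> has_derivative \<Phi>' \<xi>) (at \<xi>)"
        "continuous_on UNIV (\<lambda>(\<xi>, \<eta>). \<Phi>' \<xi> \<eta>)" "\<And>\<xi>. \<xi> \<in> ?R \<Longrightarrow> inj (\<Phi>' \<xi>)"
      using reference_map_derivative[OF ref] by blast
    obtain w where w: "w \<in> shape_functions ty" "\<And>\<xi>. \<xi> \<in> ?R \<Longrightarrow> v (\<Phi> \<xi>) = w \<xi>"
      using v \<Phi> by (auto simp: fe_space_def)
    obtain w' where w': "\<And>\<xi>. (w has_derivative w' \<xi>) (at \<xi>)"
        "continuous_on UNIV (\<lambda>(\<xi>, \<eta>). w' \<xi> \<eta>)"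
      using shape_function_derivative[OF w(1)] by blast
    have "inj_on \<Phi> ?R"
      using ref by (simp add: reference_map_def)
    then show ?thesis
      by (rule gradient_of_pullback_bounded[OF compact_reference_element \<Phi>'(1,2) _ \<Phi>'(3) w' w(2)])
  qed
  then obtain B where B: "\<And>\<Phi> \<xi>. \<Phi> \<in> \<T> \<Longrightarrow> \<xi> \<in> interior ?R \<Longrightarrow>
      \<exists>D. GDERIV v (\<Phi> \<xi>) :> D \<and> norm D \<le> B \<Phi>"
    by metis
  have fin: "finite \<T>"
    using mesh by (simp add: is_mesh_def)
  have "GDERIV v x :> grad v x \<and> norm (grad v x) \<le> (\<Sum>\<Phi>\<in>\<T>. \<bar>B \<Phi>\<bar>)"
    if x: "x \<in> element_interiors ty \<T>" for x
  proof -
    obtain \<Phi> \<xi> where \<Phi>: "\<Phi> \<in> \<T>" "\<xi> \<in> interior ?R" "x = \<Phi> \<xi>"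
      using x by (auto simp: element_interiors_def)
    obtain D where D: "GDERIV v x :> D" "norm D \<le> B \<Phi>"
      using B[OF \<Phi>(1,2)] \<Phi>(3) by blast
    have "B \<Phi> \<le> (\<Sum>\<Phi>\<in>\<T>. \<bar>B \<Phi>\<bar>)"
      using member_le_sum[of \<Phi> \<T> "\<lambda>\<Phi>. \<bar>B \<Phi>\<bar>"] \<Phi>(1) fin by auto
    with D show ?thesis
      by (simp add: grad_eqI[OF D(1)])
  qed
  then show ?thesis
    using that by blast
qed

text \<open>The directional derivatives are pointwise limits of difference quotients, which are
  Borel measurable whenever \<open>v\<close> is.\<close>
lemma borel_measurable_grad:
  fixes v :: "'a::euclidean_space \<Rightarrow> real"
  assumes v: "v \<in> borel_measurable borel" and grad: "\<And>x. x \<in> A \<Longrightarrow> GDERIV v x :> grad v x"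
  shows "grad v \<in> borel_measurable (lebesgue_on A)"
proof (subst borel_measurable_euclidean_space, intro ballI)
  fix b :: 'a
  show "(\<lambda>x. grad v x \<bullet> b) \<in> borel_measurable (lebesgue_on A)"
  proof (rule borel_measurable_LIMSEQ_real)
    let ?t = "\<lambda>n. inverse (real (Suc n))"
    show "(\<lambda>n. (v (x + ?t n *\<^sub>R b) - v x) / ?t n) \<longlonglongrightarrow> grad v x \<bullet> b"
      if "x \<in> space (lebesgue_on A)" for x
    proof -
      have "(v has_derivative (\<lambda>h. h \<bullet> grad v x)) (at (x + 0 *\<^sub>R b))"
        using grad that by (simp add: gderiv_def)
      then have "((\<lambda>t. v (x + t *\<^sub>R b)) has_derivative (\<lambda>t. (t *\<^sub>R b) \<bullet> grad v x)) (at 0)"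
        by (rule has_derivative_compose[rotated]) (auto intro!: derivative_eq_intros)
      then have "((\<lambda>t. v (x + t *\<^sub>R b)) has_field_derivative grad v x \<bullet> b) (at 0)"
        by (simp add: has_field_derivative_def inner_commute mult_commute_abs)
      then have "((\<lambda>t. (v (x + t *\<^sub>R b) - v x) / t) \<longlongrightarrow> grad v x \<bullet> b) (at 0)"
        by (simp add: DERIV_def)
      moreover have "filterlim ?t (at 0) sequentially"
        by (rule filterlim_atI[OF LIMSEQ_inverse_real_of_nat]) simp
      ultimately show ?thesis
        by (rule filterlim_compose)
    qed
    have "(\<lambda>x. (v (x + ?t n *\<^sub>R b) - v x) / ?t n) \<in> borel_measurable borel" for n
      using v by measurable
    then show "(\<lambda>x. (v (x + ?t n *\<^sub>R b) - v x) / ?t n) \<in> borel_measurable (lebesgue_on A)" for n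
      by (intro measurable_restrict_space1 measurable_completion) simp
  qed
qed

section \<open>The discrete spaces\<close>

lemma fe_space_borel_measurable:
  assumes "v \<in> fe_space ty \<Omega> \<T>"
  shows "v \<in> borel_measurable borel"
proof -
  have "(\<lambda>x. indicator (closure \<Omega>) x *\<^sub>R v x) \<in> borel_measurable borel"
    using assms by (intro borel_measurable_continuous_on_indicator) (auto simp: fe_space_def)
  moreover have "(\<lambda>x. indicator (closure \<Omega>) x *\<^sub>R v x) = v"
    using assms by (intro ext) (auto simp: fe_space_def indicator_def)
  ultimately show ?thesis by simp
qed

lemma fe_space_bounded:
  assumes v: "v \<in> fe_space ty \<Omega> \<T>" and \<Omega>: "bounded \<Omega>"
  obtains B where "\<And>x. \<bar>v x\<bar> \<le> B"
proof -
  have "compact (v ` closure \<Omega>)"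
    using v \<Omega> by (intro compact_continuous_image) (auto simp: fe_space_def)
  then obtain B where B: "B > 0" "\<And>x. x \<in> closure \<Omega> \<Longrightarrow> \<bar>v x\<bar> \<le> B"
    by (fastforce dest!: compact_imp_bounded simp: bounded_pos)
  have "\<bar>v x\<bar> \<le> B" for x
    using B v by (cases "x \<in> closure \<Omega>") (auto simp: fe_space_def)
  then show ?thesis by (rule that)
qed

lemma indicator_in_fe_space:
  fixes \<Omega> :: "(real ^ 'd) set"
  assumes mesh: "is_mesh ty \<Omega> \<T>"
  shows "indicator (closure \<Omega>) \<in> fe_space ty \<Omega> \<T>"
proof -
  have one: "(\<lambda>_ :: real ^ 'd. 1) \<in> shape_functions ty"
  proof (cases ty)
    case Simplicial
    have "(\<lambda>\<xi> :: real ^ 'd. 1) = (\<lambda>\<xi>. 1 + 0 \<bullet> \<xi>)"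
      by simp
    then have "\<exists>c a. (\<lambda>\<xi> :: real ^ 'd. 1) = (\<lambda>\<xi>. c + a \<bullet> \<xi>)"
      by (intro exI)
    then show ?thesis
      by (simp add: Simplicial)
  next
    case Cubical
    have "(\<lambda>\<xi> :: real ^ 'd. 1) =
        (\<lambda>\<xi>. \<Sum>S\<in>UNIV. (if S = {} then 1 else 0) * (\<Prod>i\<in>S. \<xi> $ i))"
      by (simp add: if_distrib[of "\<lambda>c. c * _"] cong: if_cong)
    with Cubical show ?thesis by auto
  qed
  have "continuous_on (closure \<Omega>) (indicator (closure \<Omega>) :: _ \<Rightarrow> real)"
    by (subst continuous_on_cong[OF refl, of _ _ "\<lambda>_. 1"]) (auto simp: indicator_def)
  moreover have "\<forall>\<Phi>\<in>\<T>. \<forall>\<xi>\<in>reference_element ty. indicator (closure \<Omega>) (\<Phi> \<xi>) = (1::real)"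
    using mesh by (auto simp: is_mesh_def indicator_def)
  ultimately show ?thesis
    using one by (auto simp: fe_space_def)
qed

lemma fun_span_mono:
  assumes "finite J" "I \<subseteq> J"
  shows "fun_span N I \<subseteq> fun_span N J"
proof
  fix v assume "v \<in> fun_span N I"
  then obtain c where v: "v = (\<lambda>x. \<Sum>i\<in>I. c i * N i x)"
    by (auto simp: fun_span_def)
  have "v = (\<lambda>x. \<Sum>i\<in>J. (if i \<in> I then c i else 0) * N i x)"
    unfolding v using assms by (intro ext sum.mono_neutral_cong_left) auto
  then show "v \<in> fun_span N J"
    by (auto simp: fun_span_def)
qed

lemma fun_span_split:
  assumes "finite J" "v \<in> fun_span N J"
  obtains u w where "u \<in> fun_span N (J - A)" "w \<in> fun_span N (J \<inter> A)" "v = (\<lambda>x. u x + w x)"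
proof -
  obtain c where v: "v = (\<lambda>x. \<Sum>i\<in>J. c i * N i x)"
    using assms(2) by (auto simp: fun_span_def)
  show ?thesis
  proof (rule that)
    show "v = (\<lambda>x. (\<Sum>i\<in>J - A. c i * N i x) + (\<Sum>i\<in>J \<inter> A. c i * N i x))"
      unfolding v using sum.Int_Diff[OF assms(1)] by (auto simp: add.commute)
  qed (auto simp: fun_span_def)
qed

text \<open>Sums over infinite index sets are zero by convention, so a span that is not trivial has a
  finite index set. Combined with the constant function, this yields the finiteness of the set of
  regular vertices.\<close>
lemma finite_if_fun_span_nonzero:
  assumes "v \<in> fun_span N J" "v x \<noteq> 0"
  shows "finite J"
  using assms by (auto simp: fun_span_def intro: ccontr)

section \<open>Surface integrals\<close>

lemma surface_inner_commute: "surface_inner \<Gamma> u v = surface_inner \<Gamma> v u"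
  by (simp add: surface_inner_def mult.commute)

text \<open>On a set of finite measure, \<open>\<bar>h\<bar> \<le> h\<^sup>2 + 1\<close> dominates a square integrable function by an
  integrable one.\<close>
lemma surface_square_integrable_imp_product_integrable:
  assumes h: "surface_square_integrable \<Gamma> h"
    and \<Gamma>: "\<Gamma> \<in> sets borel" "emeasure surface_measure \<Gamma> < \<infinity>"
    and v: "v \<in> borel_measurable borel" "\<And>x. \<bar>v x\<bar> \<le> B"
  shows "set_integrable surface_measure \<Gamma> (\<lambda>x. h x * v x)"
proof -
  let ?M = "surface_measure :: (real ^ 'a) measure"
  have hm: "(\<lambda>x. indicator \<Gamma> x *\<^sub>R h x) \<in> borel_measurable ?M"
    and h2: "integrable ?M (\<lambda>x. indicator \<Gamma> x *\<^sub>R (h x)\<^sup>2)"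
    using h by (auto simp: surface_square_integrable_def set_borel_measurable_def set_integrable_def)
  have "integrable ?M (indicator \<Gamma> :: _ \<Rightarrow> real)"
    using \<Gamma> by simp
  then have bound: "integrable ?M (\<lambda>x. B * (indicator \<Gamma> x *\<^sub>R (h x)\<^sup>2 + indicator \<Gamma> x))"
    using h2 by auto
  have "v \<in> borel_measurable ?M"
    using v(1) by (simp cong: measurable_cong_sets)
  then have "(\<lambda>x. (indicator \<Gamma> x *\<^sub>R h x) * v x) \<in> borel_measurable ?M"
    using hm by measurable
  then have meas: "(\<lambda>x. indicator \<Gamma> x *\<^sub>R (h x * v x)) \<in> borel_measurable ?M"
    by (simp add: mult.assoc)
  have "\<bar>h x * v x\<bar> \<le> \<bar>B * ((h x)\<^sup>2 + 1)\<bar>" for x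
  proof -
    have "0 \<le> (\<bar>h x\<bar> - 1)\<^sup>2" by simp
    then have "\<bar>h x\<bar> \<le> (h x)\<^sup>2 + 1"
      by (simp add: power2_diff)
    then have "\<bar>h x\<bar> * \<bar>v x\<bar> \<le> ((h x)\<^sup>2 + 1) * B"
      using v(2)[of x] by (intro mult_mono) auto
    then show ?thesis
      by (metis abs_ge_self abs_mult mult.commute order_trans)
  qed
  then show ?thesis
    unfolding set_integrable_def
    by (intro Bochner_Integration.integrable_bound[OF bound meas] AE_I2)
       (auto simp: indicator_def)
qed

lemma bounded_imp_surface_square_integrable:
  assumes \<Gamma>: "\<Gamma> \<in> sets borel" "emeasure surface_measure \<Gamma> < \<infinity>"
    and v: "v \<in> borel_measurable borel" "\<And>x. \<bar>v x\<bar> \<le> B"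
  shows "surface_square_integrable \<Gamma> v"
proof -
  have m: "v \<in> borel_measurable surface_measure"
    using v(1) by (simp cong: measurable_cong_sets)
  have "(v x)\<^sup>2 \<le> B\<^sup>2" for x
    using power_mono[OF v(2)[of x], of 2] by simp
  then have "integrable surface_measure (\<lambda>x. indicator \<Gamma> x *\<^sub>R (v x)\<^sup>2)"
    using \<Gamma> m by (intro integrableI_bounded_set_indicator[where B = "B\<^sup>2"]) auto
  then show ?thesis
    using \<Gamma> m by (auto simp: surface_square_integrable_def set_borel_measurable_def set_integrable_def)
qed

lemma surface_inner_add_right:
  assumes "set_integrable surface_measure \<Gamma> (\<lambda>x. u x * v x)"
    and "set_integrable surface_measure \<Gamma> (\<lambda>x. u x * w x)"
  shows "surface_inner \<Gamma> u (\<lambda>x. v x + w x) = surface_inner \<Gamma> u v + surface_inner \<Gamma> u w"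
  using set_integral_add(2)[OF assms] by (simp add: surface_inner_def distrib_left)

lemma surface_inner_union:
  assumes int: "set_integrable surface_measure (A \<union> B) (\<lambda>x. u x * v x)"
    and sets: "A \<in> sets borel" "B \<in> sets borel"
    and null: "emeasure surface_measure (A \<inter> B) = 0"
  shows "surface_inner (A \<union> B) u v = surface_inner A u v + surface_inner B u v"
  unfolding surface_inner_def
proof (rule set_integral_Un_AE)
  have "A \<inter> B \<in> null_sets surface_measure"
    using sets null by (intro null_setsI) auto
  then have "AE x in surface_measure. x \<notin> A \<inter> B"
    by (rule AE_not_in)
  then show "AE x in surface_measure. \<not> (x \<in> A \<and> x \<in> B)"
    by simp
qed (use sets in \<open>auto intro: set_integrable_subset[OF int]\<close>)

section \<open>The bilinear form of the flow problem\<close>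

text \<open>Integrals of functions that are not integrable are zero by convention, so additivity of the
  form, in the test function as well as in the domain, rests on the integrability of its integrand.\<close>
locale fe_flow =
  fixes ty :: element_type and \<Omega> :: "(real ^ 'd) set"
    and \<T> :: "(real ^ 'd \<Rightarrow> real ^ 'd) set" and k :: "real ^ 'd \<Rightarrow> real" and K :: real
  assumes mesh: "is_mesh ty \<Omega> \<T>"
    and open_domain: "open \<Omega>" and bounded_domain: "bounded \<Omega>"
    and k_measurable: "k \<in> borel_measurable (lebesgue_on \<Omega>)"
    and k_bounded: "\<And>x. x \<in> \<Omega> \<Longrightarrow> \<bar>k x\<bar> \<le> K"
begin

lemma negligible_off_interiors: "A \<subseteq> \<Omega> \<Longrightarrow> negligible (A - element_interiors ty \<T>)"
  using negligible_off_element_interiors[OF mesh] closure_subset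
  by (rule_tac negligible_subset) blast+

text \<open>Off the null set left by the element interiors, the integrand is measurable and bounded.\<close>
lemma flow_integrand_integrable:
  assumes u: "u \<in> fe_space ty \<Omega> \<T>" and v: "v \<in> fe_space ty \<Omega> \<T>"
    and A: "A \<in> sets lebesgue" "A \<subseteq> \<Omega>"
  shows "(\<lambda>x. k x * (grad u x \<bullet> grad v x)) absolutely_integrable_on A"
proof -
  define X where "X = A \<inter> element_interiors ty \<T>"
  have X: "X \<in> sets lebesgue" "X \<subseteq> \<Omega>" "X \<subseteq> element_interiors ty \<T>"
    using A open_element_interiors[OF mesh] by (auto simp: X_def)
  obtain B where B: "\<And>x. x \<in> element_interiors ty \<T> \<Longrightarrow> GDERIV u x :> grad u x"
      "\<And>x. x \<in> element_interiors ty \<T> \<Longrightarrow> norm (grad u x) \<le> B"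
    using fe_space_gradient[OF mesh u] by blast
  obtain C where C: "\<And>x. x \<in> element_interiors ty \<T> \<Longrightarrow> GDERIV v x :> grad v x"
      "\<And>x. x \<in> element_interiors ty \<T> \<Longrightarrow> norm (grad v x) \<le> C"
    using fe_space_gradient[OF mesh v] by blast
  have "grad u \<in> borel_measurable (lebesgue_on X)" "grad v \<in> borel_measurable (lebesgue_on X)"
    using B C X fe_space_borel_measurable u v by (auto intro!: borel_measurable_grad)
  moreover have "k \<in> borel_measurable (lebesgue_on X)"
    using k_measurable X(2) by (rule measurable_restrict_mono)
  ultimately have meas: "(\<lambda>x. k x * (grad u x \<bullet> grad v x)) \<in> borel_measurable (lebesgue_on X)"
    by measurable
  have "X \<in> lmeasurable"
    using X bounded_domain bounded_subset by (blast intro: bounded_set_imp_lmeasurable)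
  then have const: "(\<lambda>x. K * (B * C)) integrable_on X"
    by (rule integrable_on_const)
  have "norm (k x * (grad u x \<bullet> grad v x)) \<le> K * (B * C)" if "x \<in> X" for x
  proof -
    have "\<bar>grad u x \<bullet> grad v x\<bar> \<le> norm (grad u x) * norm (grad v x)"
      by (rule Cauchy_Schwarz_ineq2)
    also have "\<dots> \<le> B * C"
      using that X(3) B(2) C(2) by (intro mult_mono') auto
    finally show ?thesis
      using that X k_bounded[of x] unfolding real_norm_def abs_mult by (intro mult_mono') auto
  qed
  then have "(\<lambda>x. k x * (grad u x \<bullet> grad v x)) absolutely_integrable_on X"
    by (rule measurable_bounded_by_integrable_imp_absolutely_integrable[OF meas X(1) const])
  then show ?thesis
    by (rule absolutely_integrable_spike_set)
       (auto simp: X_def intro: negligible_subset[OF negligible_off_interiors[OF A(2)]])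
qed

lemma flow_form_eq_integral:
  assumes "u \<in> fe_space ty \<Omega> \<T>" "v \<in> fe_space ty \<Omega> \<T>" "A \<in> sets lebesgue" "A \<subseteq> \<Omega>"
  shows "flow_form k A u v = integral A (\<lambda>x. k x * (grad u x \<bullet> grad v x))"
  unfolding flow_form_def
  using flow_integrand_integrable[OF assms] assms(3)
  by (intro lebesgue_integral_eq_integral) (auto simp: integrable_restrict_space set_integrable_def)

lemma flow_form_add_right:
  assumes p: "p \<in> fe_space ty \<Omega> \<T>" and u: "u \<in> fe_space ty \<Omega> \<T>" and v: "v \<in> fe_space ty \<Omega> \<T>"
    and uv: "(\<lambda>x. u x + v x) \<in> fe_space ty \<Omega> \<T>"
    and A: "A \<in> sets lebesgue" "A \<subseteq> \<Omega>"
  shows "flow_form k A p (\<lambda>x. u x + v x) = flow_form k A p u + flow_form k A p v"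
proof -
  let ?F = "\<lambda>v x. k x * (grad p x \<bullet> grad v x)"
  have add: "grad (\<lambda>x. u x + v x) x = grad u x + grad v x" if "x \<in> element_interiors ty \<T>" for x
  proof -
    have "GDERIV u x :> grad u x" "GDERIV v x :> grad v x"
      using fe_space_gradient[OF mesh u] fe_space_gradient[OF mesh v] that by blast+
    then show ?thesis
      by (intro grad_eqI GDERIV_add)
  qed
  have "integral A (?F (\<lambda>x. u x + v x)) = integral A (\<lambda>x. ?F u x + ?F v x)"
    by (rule integral_spike[OF negligible_off_interiors[OF A(2)]])
       (auto simp: add inner_add_right distrib_left)
  also have "\<dots> = integral A (?F u) + integral A (?F v)"
    using flow_integrand_integrable[OF p u A] flow_integrand_integrable[OF p v A]
    by (intro integral_add) (auto simp: absolutely_integrable_on_def)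
  finally show ?thesis
    using p u v uv A by (simp add: flow_form_eq_integral)
qed

lemma flow_form_union:
  assumes u: "u \<in> fe_space ty \<Omega> \<T>" and v: "v \<in> fe_space ty \<Omega> \<T>"
    and A: "A \<in> sets lebesgue" "A \<subseteq> \<Omega>" and B: "B \<in> sets lebesgue" "B \<subseteq> \<Omega>"
    and disj: "A \<inter> B = {}" and null: "negligible (\<Omega> - (A \<union> B))"
  shows "flow_form k \<Omega> u v = flow_form k A u v + flow_form k B u v"
proof -
  let ?F = "\<lambda>x. k x * (grad u x \<bullet> grad v x)"
  have \<Omega>: "\<Omega> \<in> sets lebesgue"
    using open_domain by simp
  have "integral \<Omega> ?F = integral (A \<union> B) ?F"
    using A B by (intro integral_spike_set) (auto intro: negligible_subset[OF null])
  also have "\<dots> = integral A ?F + integral B ?F"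
    using flow_integrand_integrable[OF u v A] flow_integrand_integrable[OF u v B] disj
    by (intro integral_Un) (auto simp: absolutely_integrable_on_def)
  finally show ?thesis
    using u v A B \<Omega> by (simp add: flow_form_eq_integral)
qed

end

lemma flow_form_indicator:
  assumes "open \<Omega>" "A \<subseteq> \<Omega>"
  shows "flow_form k A p (indicator (closure \<Omega>)) = 0"
proof -
  have "grad (indicator (closure \<Omega>) :: _ \<Rightarrow> real) x = 0" if "x \<in> A" for x
  proof (rule grad_eqI)
    have "((\<lambda>_. 1 :: real) has_derivative (\<lambda>_. 0)) (at x)"
      by simp
    then have "((indicator (closure \<Omega>) :: _ \<Rightarrow> real) has_derivative (\<lambda>_. 0)) (at x)"
      by (rule has_derivative_transform_within_open[OF _ assms(1)])
         (use assms that closure_subset in \<open>auto simp: indicator_def\<close>)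
    then show "GDERIV (indicator (closure \<Omega>) :: _ \<Rightarrow> real) x :> 0"
      by (simp add: gderiv_def)
  qed
  then have "flow_form k A p (indicator (closure \<Omega>)) = (LINT x|lebesgue_on A. 0)"
    unfolding flow_form_def by (intro Bochner_Integration.integral_cong) auto
  then show ?thesis by simp
qed

lemma surface_inner_indicator:
  assumes "\<Gamma> \<subseteq> closure \<Omega>"
  shows "surface_inner \<Gamma> u (indicator (closure \<Omega>)) = (LINT x:\<Gamma>|surface_measure. u x)"
  unfolding surface_inner_def set_lebesgue_integral_def
  using assms by (intro Bochner_Integration.integral_cong) (auto simp: indicator_def)

section \<open>Local conservation\<close>

theorem mainTheorem2:
  fixes a b :: "real ^ 'd"
    and \<Omega> \<Omega>f \<Gamma>D \<Gamma>N \<Omega>1 \<Omega>2 L \<Gamma>1N \<Gamma>2N :: "(real ^ 'd) set"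
    and k g h p qD qL1 qL2 :: "real ^ 'd \<Rightarrow> real"
    and km kf :: real
    and ty :: element_type
    and \<T> :: "(real ^ 'd \<Rightarrow> real ^ 'd) set"
    and J :: "(real ^ 'd) set"
    and N :: "real ^ 'd \<Rightarrow> real ^ 'd \<Rightarrow> real"
    and Sh Vh Gh GLh :: "(real ^ 'd \<Rightarrow> real) set"
  assumes dim: "CARD('d) \<in> {2, 3}"
    and domain: "\<Omega> = box a b" "\<Omega> \<noteq> {}"
    and boundary: "boundary_decomposition \<Omega> \<Gamma>D \<Gamma>N"
    and fracture: "finite_union_of_boxes \<Omega>f" "\<Omega>f \<subseteq> \<Omega>"
    and permeability: "km > 0" "kf > 0"
      "\<And>x. x \<in> \<Omega> - \<Omega>f \<Longrightarrow> k x = km" "\<And>x. x \<in> \<Omega>f \<Longrightarrow> k x = kf"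
    and neumann_datum: "surface_square_integrable \<Gamma>N h"
    and mesh: "is_mesh ty \<Omega> \<T>" "one_irregular ty \<T>"
    and nodes: "J = regular_vertices ty \<T>"
    and Sh: "Sh = fe_space ty \<Omega> \<T>" "lagrange_basis N J Sh"
    and Vh: "Vh = with_boundary_values Sh \<Gamma>D (\<lambda>x. 0)" "Vh = fun_span N (J - \<Gamma>D)"
    and Gh: "Gh = fun_span N (J \<inter> \<Gamma>D)"
    and p: "p \<in> with_boundary_values Sh \<Gamma>D g"
      "\<And>v. v \<in> Vh \<Longrightarrow> flow_form k \<Omega> p v = surface_inner \<Gamma>N h v"
    and qD: "qD \<in> Gh"
      "\<And>v. v \<in> Gh \<Longrightarrow>
         surface_inner \<Gamma>D qD v = flow_form k \<Omega> p v - surface_inner \<Gamma>N h v"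
    and subdomains: "subdomain_pair \<Omega> \<Gamma>N \<Omega>1 \<Omega>2"
    and interface: "L = frontier \<Omega>1 \<inter> frontier \<Omega>2"
      "\<Gamma>1N = frontier \<Omega>1 \<inter> \<Gamma>N" "\<Gamma>2N = frontier \<Omega>2 \<inter> \<Gamma>N"
      "frontier \<Omega>1 = L \<union> \<Gamma>1N" "frontier \<Omega>2 = L \<union> \<Gamma>2N \<union> \<Gamma>D"
    and GLh: "GLh = fun_span N (interface_nodes N J L)"
    and qL1: "qL1 \<in> GLh"
      "\<And>v. v \<in> Sh \<Longrightarrow>
         surface_inner L v qL1 = flow_form k \<Omega>1 p v - surface_inner \<Gamma>1N h v"
    and qL2: "qL2 \<in> GLh"
      "\<And>v. v \<in> Sh \<Longrightarrow>
         surface_inner L v qL2 =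
           flow_form k \<Omega>2 p v - surface_inner \<Gamma>2N h v - surface_inner \<Gamma>D v qD"
  shows "((LINT x:L|surface_measure. qL1 x) + (LINT x:\<Gamma>1N|surface_measure. h x) = 0 \<and>
          (LINT x:L|surface_measure. qL2 x) + (LINT x:\<Gamma>2N|surface_measure. h x)
            + (LINT x:\<Gamma>D|surface_measure. qD x) = 0) \<and>
         (\<forall>v\<in>GLh. surface_inner L v (\<lambda>x. qL1 x + qL2 x) = 0)"
proof -
  have card: "CARD('d) \<ge> 2"
    using dim by auto
  have open_\<Omega>: "open \<Omega>" and bounded_\<Omega>: "bounded \<Omega>"
    using domain by auto
  have open12: "open \<Omega>1" "open \<Omega>2" and sub12: "\<Omega>1 \<subseteq> \<Omega>" "\<Omega>2 \<subseteq> \<Omega>" and disj12: "\<Omega>1 \<inter> \<Omega>2 = {}"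
    and fill12: "closure \<Omega>1 \<union> closure \<Omega>2 = closure \<Omega>"
    and finite12: "emeasure surface_measure (frontier \<Omega>1) < \<infinity>"
      "emeasure surface_measure (frontier \<Omega>2) < \<infinity>"
    and null_LN: "emeasure surface_measure (frontier \<Omega>1 \<inter> frontier \<Omega>2 \<inter> \<Gamma>N) = 0"
    using subdomains by (auto simp: subdomain_pair_def)
  have frontier_sub: "frontier \<Omega>1 \<subseteq> closure \<Omega>" "frontier \<Omega>2 \<subseteq> closure \<Omega>"
    using fill12 by (auto simp: frontier_def)
  have borel_D: "\<Gamma>D \<in> sets borel" and borel_N: "\<Gamma>N \<in> sets borel"
    and "\<Gamma>N \<subseteq> frontier \<Omega>"
    using boundary closure_subset[of \<Gamma>N] by (auto simp: boundary_decomposition_def)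
  moreover have "frontier \<Omega> \<subseteq> frontier \<Omega>1 \<union> frontier \<Omega>2"
    using fill12 sub12 open12 open_\<Omega> by (auto simp: frontier_def interior_open)
  ultimately have N_eq: "\<Gamma>N = \<Gamma>1N \<union> \<Gamma>2N"
    using interface(2,3) by blast
  have D_sub: "\<Gamma>D \<subseteq> frontier \<Omega>2"
    using interface(5) by blast
  have borel_front: "frontier X \<in> sets borel" for X :: "(real ^ 'd) set"
    by (intro borel_closed frontier_closed)
  have borel_L: "L \<in> sets borel" and borel_1N: "\<Gamma>1N \<in> sets borel" and borel_2N: "\<Gamma>2N \<in> sets borel"
    using interface(1-3) borel_N borel_front by auto
  have finite_surface: "emeasure surface_measure X < \<infinity>"
    if "X \<subseteq> frontier \<Omega>1 \<union> frontier \<Omega>2" for X :: "(real ^ 'd) set"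
  proof -
    have "emeasure surface_measure X \<le> emeasure surface_measure (frontier \<Omega>1 \<union> frontier \<Omega>2)"
      using that borel_front by (intro emeasure_mono) auto
    also have "\<dots> \<le> emeasure surface_measure (frontier \<Omega>1) + emeasure surface_measure (frontier \<Omega>2)"
      using borel_front by (intro emeasure_subadditive) auto
    also have "\<dots> < \<infinity>"
      using finite12 by (simp add: ennreal_add_less_top)
    finally show ?thesis .
  qed
  interpret flow: fe_flow ty \<Omega> \<T> k "max km kf"
  proof
    have "\<Omega>f \<in> sets borel"
      using fracture(1) by (auto simp: finite_union_of_boxes_def intro!: sets.finite_Union)
    then have "(\<lambda>x. if x \<in> \<Omega>f then kf else km) \<in> borel_measurable borel"
      by (intro measurable_If_set) auto
    then have "(\<lambda>x. if x \<in> \<Omega>f then kf else km) \<in> borel_measurable (lebesgue_on \<Omega>)"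
      by (intro measurable_restrict_space1 measurable_completion) simp
    then show "k \<in> borel_measurable (lebesgue_on \<Omega>)"
      by (rule measurable_cong[THEN iffD1, rotated]) (use permeability(3,4) in auto)
    show "\<bar>k x\<bar> \<le> max km kf" if "x \<in> \<Omega>" for x
      using permeability that by (cases "x \<in> \<Omega>f") auto
  qed (use mesh open_\<Omega> bounded_\<Omega> in auto)
  let ?one = "indicator (closure \<Omega>) :: real ^ 'd \<Rightarrow> real"
  have one: "?one \<in> Sh"
    unfolding Sh(1) by (rule indicator_in_fe_space[OF mesh(1)])
  have Sh_span: "Sh = fun_span N J"
    using Sh(2) by (simp add: lagrange_basis_def)
  obtain x0 where "x0 \<in> \<Omega>"
    using domain(2) by blast
  then have "?one x0 \<noteq> 0"
    using closure_subset[of \<Omega>] by auto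
  then have finite_J: "finite J"
    using one unfolding Sh_span by (rule finite_if_fun_span_nonzero[rotated])
  have GLh_Sh: "GLh \<subseteq> Sh" and Gh_Sh: "Gh \<subseteq> Sh" and Vh_Sh: "Vh \<subseteq> Sh"
    unfolding GLh Gh Vh(2) Sh_span
    by (intro fun_span_mono finite_J; auto simp: interface_nodes_def)+
  have p_Sh: "p \<in> Sh"
    using p(1) by (simp add: with_boundary_values_def)
  have Sh_int: "set_integrable surface_measure X (\<lambda>x. u x * v x)"
    if uv: "u \<in> Sh" "v \<in> Sh" and X: "X \<in> sets borel" "X \<subseteq> frontier \<Omega>1 \<union> frontier \<Omega>2" for u v X
  proof -
    have u: "u \<in> fe_space ty \<Omega> \<T>" and v: "v \<in> fe_space ty \<Omega> \<T>"
      using uv by (simp_all add: Sh(1))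
    obtain A where A: "\<And>x. \<bar>u x\<bar> \<le> A"
      using fe_space_bounded[OF u bounded_\<Omega>] by blast
    obtain B where B: "\<And>x. \<bar>v x\<bar> \<le> B"
      using fe_space_bounded[OF v bounded_\<Omega>] by blast
    show ?thesis
      by (rule surface_square_integrable_imp_product_integrable
          [OF bounded_imp_surface_square_integrable X(1) _ _ B])
         (rule X(1) finite_surface[OF X(2)] fe_space_borel_measurable[OF u] A
          fe_space_borel_measurable[OF v])+
  qed
  have h_int: "set_integrable surface_measure \<Gamma>N (\<lambda>x. h x * v x)" if v: "v \<in> Sh" for v
  proof -
    have v': "v \<in> fe_space ty \<Omega> \<T>"
      using v by (simp add: Sh(1))
    obtain B where B: "\<And>x. \<bar>v x\<bar> \<le> B"
      using fe_space_bounded[OF v' bounded_\<Omega>] by blast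
    have "\<Gamma>N \<subseteq> frontier \<Omega>1 \<union> frontier \<Omega>2"
      using interface(2,3) N_eq by blast
    from surface_square_integrable_imp_product_integrable[OF neumann_datum borel_N
        finite_surface[OF this] fe_space_borel_measurable[OF v'] B]
    show ?thesis .
  qed
  \<comment> \<open>Galerkin's equation covers the test functions that vanish on \<open>\<Gamma>\<^sub>D\<close>, the definition of the
    boundary flux those spanned by the nodes on \<open>\<Gamma>\<^sub>D\<close>. Together they state one identity on all of
    \<open>S\<^sup>h\<close>, because the boundary flux pairs to zero with the former.\<close>
  have residual: "surface_inner \<Gamma>D qD v = flow_form k \<Omega> p v - surface_inner \<Gamma>N h v"
    if v: "v \<in> Sh" for v
  proof -
    obtain u w where u: "u \<in> Vh" and w: "w \<in> Gh" and v_eq: "v = (\<lambda>x. u x + w x)"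
      using fun_span_split[OF finite_J] v unfolding Sh_span Vh(2) Gh by blast
    have Sh': "u \<in> Sh" "w \<in> Sh" "qD \<in> Sh"
      using u w qD(1) Vh_Sh Gh_Sh by auto
    have "surface_inner \<Gamma>D qD u = 0"
      unfolding surface_inner_def set_lebesgue_integral_def
      using u by (intro integral_eq_zero_AE AE_I2) (auto simp: Vh(1) with_boundary_values_def indicator_def)
    then have "surface_inner \<Gamma>D qD v = surface_inner \<Gamma>D qD w"
      using surface_inner_add_right[of \<Gamma>D qD u w] Sh_int[of qD _ \<Gamma>D] Sh' borel_D D_sub
      by (simp add: v_eq le_supI2)
    moreover have "flow_form k \<Omega> p v = flow_form k \<Omega> p u + flow_form k \<Omega> p w"
      unfolding v_eq using p_Sh Sh' v open_\<Omega> unfolding Sh(1) v_eq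
      by (intro flow.flow_form_add_right) auto
    moreover have "surface_inner \<Gamma>N h v = surface_inner \<Gamma>N h u + surface_inner \<Gamma>N h w"
      unfolding v_eq using Sh' by (intro surface_inner_add_right h_int)
    ultimately show ?thesis
      using p(2)[OF u] qD(2)[OF w] by simp
  qed
  \<comment> \<open>What the subdomains leave out lies on their boundaries, which have finite surface
    measure and are therefore Lebesgue null.\<close>
  have "negligible (\<Omega> - (\<Omega>1 \<union> \<Omega>2))"
  proof (rule negligible_subset)
    show "negligible (frontier \<Omega>1 \<union> frontier \<Omega>2)"
      using finite12 borel_front card
      by (intro negligible_Un finite_surface_measure_imp_negligible)
    show "\<Omega> - (\<Omega>1 \<union> \<Omega>2) \<subseteq> frontier \<Omega>1 \<union> frontier \<Omega>2"
      using fill12 closure_subset[of \<Omega>] open12 by (auto simp: frontier_def interior_open)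
  qed
  then have flow_split: "flow_form k \<Omega> p v = flow_form k \<Omega>1 p v + flow_form k \<Omega>2 p v"
    if "v \<in> Sh" for v
    using that p_Sh open12 sub12 disj12 unfolding Sh(1) by (intro flow.flow_form_union) auto
  have neumann_split: "surface_inner \<Gamma>N h v = surface_inner \<Gamma>1N h v + surface_inner \<Gamma>2N h v"
    if "v \<in> Sh" for v
    unfolding N_eq
  proof (rule surface_inner_union)
    show "set_integrable surface_measure (\<Gamma>1N \<union> \<Gamma>2N) (\<lambda>x. h x * v x)"
      using h_int[OF that] by (simp add: N_eq)
    have "\<Gamma>1N \<inter> \<Gamma>2N = frontier \<Omega>1 \<inter> frontier \<Omega>2 \<inter> \<Gamma>N"
      using interface(2,3) by blast
    then show "emeasure surface_measure (\<Gamma>1N \<inter> \<Gamma>2N) = 0"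
      using null_LN by simp
  qed (fact borel_1N borel_2N)+
  \<comment> \<open>Testing with the constant function, whose gradient vanishes in \<open>\<Omega>\<close>.\<close>
  have "(LINT x:L|surface_measure. qL1 x) + (LINT x:\<Gamma>1N|surface_measure. h x) = 0"
  proof -
    have "L \<subseteq> closure \<Omega>" "\<Gamma>1N \<subseteq> closure \<Omega>"
      using frontier_sub interface(1,2) by auto
    then show ?thesis
      using qL1(2)[OF one] flow_form_indicator[OF open_\<Omega> sub12(1), of k p]
      by (simp add: surface_inner_commute[of L ?one] surface_inner_indicator)
  qed
  moreover have "(LINT x:L|surface_measure. qL2 x) + (LINT x:\<Gamma>2N|surface_measure. h x)
      + (LINT x:\<Gamma>D|surface_measure. qD x) = 0"
  proof -
    have "L \<subseteq> closure \<Omega>" "\<Gamma>2N \<subseteq> closure \<Omega>" "\<Gamma>D \<subseteq> closure \<Omega>"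
      using frontier_sub interface(1,3) D_sub by auto
    then show ?thesis
      using qL2(2)[OF one] flow_form_indicator[OF open_\<Omega> sub12(2), of k p]
      by (simp add: surface_inner_commute[of L ?one] surface_inner_commute[of \<Gamma>D ?one] surface_inner_indicator)
  qed
  moreover have "surface_inner L v (\<lambda>x. qL1 x + qL2 x) = 0" if "v \<in> GLh" for v
  proof -
    have v: "v \<in> Sh" and q: "qL1 \<in> Sh" "qL2 \<in> Sh"
      using that qL1(1) qL2(1) GLh_Sh by auto
    have "surface_inner L v (\<lambda>x. qL1 x + qL2 x) = surface_inner L v qL1 + surface_inner L v qL2"
      using v q borel_L interface(1) by (intro surface_inner_add_right Sh_int) auto
    also have "\<dots> = flow_form k \<Omega> p v - surface_inner \<Gamma>N h v - surface_inner \<Gamma>D qD v"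
      using qL1(2)[OF v] qL2(2)[OF v] flow_split[OF v] neumann_split[OF v]
      by (simp add: surface_inner_commute[of \<Gamma>D v])
    also have "\<dots> = 0"
      using residual[OF v] by simp
    finally show ?thesis .
  qed
  ultimately show ?thesis
    by blast
qed

end
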